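(* Let $\Phi:\mathbb{B}^2\to\mathbb{C}^2$ be the map $\Phi(z_1,z_2)=\left(z_1+\frac{3\sqrt{3}}{2}z_2^2,\ z_2\right)$. Then $\Phi\in S^0(\mathbb{B}^2)$, $\Phi$ is starlike, and $\Phi$ maximizes $\mathrm{Re}\,L^1_{0,2}$ over $S^0(\mathbb{B}^2)$, that is, $\mathrm{Re}\,L^1_{0,2}(\Phi)=\max_{h\in S^0(\mathbb{B}^2)}\mathrm{Re}\,L^1_{0,2}(h)$, where $L^1_{0,2}(f):=\frac12\frac{\partial^2 f_1}{\partial z_2^2}(0)$ for a holomorphic map $f=(f_1,f_2):\mathbb{B}^2\to\mathbb{C}^2$.
   Context: $\mathbb{B}^2=\{z\in\mathbb{C}^2:\|z\|<1\}$ is the Euclidean unit ball. Univalent means holomorphic and injective. A normalized Loewner chain on $\mathbb{B}^2$ is a family $(f_t)_{t\ge 0}$ of univalent maps $f_t:\mathbb{B}^2\to\mathbb{C}^2$ such that $f_s(\mathbb{B}^2)\subset f_t(\mathbb{B}^2)$ for $0\le s\le t$, $f_t(0)=0$ and $d(f_t)_0=e^t\,\mathrm{id}$ for all $t\ge 0$. It is a normal Loewner chain if moreover $\{e^{-t}f_t\}_{t\ge0}$ is a normal family in $\mathbb{B}^2$. $S^0(\mathbb{B}^2)$ is the set of univalent maps $f:\mathbb{B}^2\to\mathbb{C}^2$ with $f(0)=0$, $df_0=\mathrm{id}$, for which there exists a normal Loewner chain $(f_t)$ with $f_0=f$. A univalent map $f:\mathbb{B}^2\to\mathbb{C}^2$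 with $f(0)=0$ is starlike if $f(\mathbb{B}^2)$ is starlike with respect to the origin, i.e. $rf(\mathbb{B}^2)\subset f(\mathbb{B}^2)$ for all $r\in[0,1]$. *)

theory Defs
  imports "HOL-Analysis.Analysis"
begin

abbreviation B2 :: "(complex ^ 2) set" where
  "B2 \<equiv> ball 0 1"

text \<open>The derivative is required to be complex linear: \<^const>\<open>has_derivative\<close> by itself
  only provides a real linear map.\<close>

definition holomorphic_map :: "(complex ^ 2 \<Rightarrow> complex ^ 2) \<Rightarrow> (complex ^ 2) set \<Rightarrow> bool" where
  "holomorphic_map f U \<longleftrightarrow>
     (\<forall>z\<in>U. \<exists>D. (f has_derivative D) (at z) \<and> (\<forall>c v. D (c *s v) = c *s D v))"

text \<open>Maps on the ball are total functions of which only the values on \<^term>\<open>B2\<close> matter.\<close>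

definition univalent :: "(complex ^ 2 \<Rightarrow> complex ^ 2) \<Rightarrow> bool" where
  "univalent f \<longleftrightarrow> holomorphic_map f B2 \<and> inj_on f B2"

text \<open>Limits are finite: families here fix the origin, so no sequence in them diverges to
  infinity uniformly on compact sets.\<close>

definition normal_family ::
    "(complex ^ 2) set \<Rightarrow> (complex ^ 2 \<Rightarrow> complex ^ 2) set \<Rightarrow> bool" where
  "normal_family U \<F> \<longleftrightarrow>
     (\<forall>F :: nat \<Rightarrow> complex ^ 2 \<Rightarrow> complex ^ 2. range F \<subseteq> \<F> \<longrightarrow>
        (\<exists>r g. strict_mono r \<and>
           (\<forall>K. compact K \<and> K \<subseteq> U \<longrightarrow> uniform_limit K (\<lambda>n. F (r n)) g sequentially)))"

text \<open>Only the maps with index \<open>t \<ge> 0\<close> matter.\<close>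

definition normalized_Loewner_chain :: "(real \<Rightarrow> complex ^ 2 \<Rightarrow> complex ^ 2) \<Rightarrow> bool" where
  "normalized_Loewner_chain f \<longleftrightarrow>
     (\<forall>t\<ge>0. univalent (f t)) \<and>
     (\<forall>s t. 0 \<le> s \<and> s \<le> t \<longrightarrow> f s ` B2 \<subseteq> f t ` B2) \<and>
     (\<forall>t\<ge>0. f t 0 = 0 \<and> (f t has_derivative (\<lambda>v. exp t *\<^sub>R v)) (at 0))"

definition normal_Loewner_chain :: "(real \<Rightarrow> complex ^ 2 \<Rightarrow> complex ^ 2) \<Rightarrow> bool" where
  "normal_Loewner_chain f \<longleftrightarrow>
     normalized_Loewner_chain f \<and>
     normal_family B2 ((\<lambda>t z. exp (- t) *\<^sub>R f t z) ` {0..})"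

definition S0 :: "(complex ^ 2 \<Rightarrow> complex ^ 2) set" where
  "S0 = {h. univalent h \<and> h 0 = 0 \<and> (h has_derivative (\<lambda>v. v)) (at 0) \<and>
            (\<exists>f. normal_Loewner_chain f \<and> (\<forall>z\<in>B2. f 0 z = h z))}"

definition starlike_map :: "(complex ^ 2 \<Rightarrow> complex ^ 2) \<Rightarrow> bool" where
  "starlike_map f \<longleftrightarrow>
     univalent f \<and> f 0 = 0 \<and> (\<forall>r\<in>{0..1::real}. (\<lambda>w. r *\<^sub>R w) ` (f ` B2) \<subseteq> f ` B2)"

definition complex_partial :: "2 \<Rightarrow> (complex ^ 2 \<Rightarrow> complex) \<Rightarrow> complex ^ 2 \<Rightarrow> complex" where
  "complex_partial j g z = deriv (\<lambda>w. g (z + w *s axis j 1)) 0"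

definition L1_02 :: "(complex ^ 2 \<Rightarrow> complex ^ 2) \<Rightarrow> complex" where
  "L1_02 f = 1 / 2 * complex_partial 2 (complex_partial 2 (\<lambda>z. f z $ 1)) 0"

definition Phi :: "complex ^ 2 \<Rightarrow> complex ^ 2" where
  "Phi z = vector [z $ 1 + complex_of_real (3 * sqrt 3 / 2) * (z $ 2)\<^sup>2, z $ 2]"

end

theory Submission
  imports Defs "HOL-Complex_Analysis.Complex_Analysis"
begin

text \<open>
  Write \<open>c = 3\<surd>3/2\<close> and let \<open>(f\<^sub>t)\<close> be a normal Loewner chain. The transition maps
  \<open>\<phi> = f\<^sub>t\<^sup>-\<^sup>1 \<circ> f\<^sub>s\<close> with \<open>t = s + d\<close> send the ball into itself, fix the origin and have derivative
  \<open>e\<^sup>-\<^sup>d\<close> there. Restrict \<open>\<phi>\<close> to the weighted disc \<open>\<zeta> \<mapsto> (x \<zeta>\<^sup>2, y \<zeta>)\<close> with \<open>x\<^sup>2 + y\<^sup>2 = 1\<close>, and pair it with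
  the same direction: \<open>g(\<zeta>) = x \<phi>\<^sub>1 / \<zeta>\<^sup>2 + y \<phi>\<^sub>2 / \<zeta>\<close>. The weights are chosen so that exactly the linear part
  and the coefficient \<open>b\<close> of \<open>z\<^sub>2\<^sup>2\<close> in \<open>\<phi>\<^sub>1\<close> survive at the origin, \<open>g(0) = e\<^sup>-\<^sup>d + b x y\<^sup>2\<close>. Since \<open>\<phi>\<close> has norm
  less than 1, \<open>|g| \<le> 1/\<rho>\<^sup>2\<close> on \<open>|\<zeta>| = \<rho>\<close>, and the maximum principle with \<open>\<rho> \<rightarrow> 1\<close> gives \<open>|g(0)| \<le> 1\<close>
  (lemma \<open>transition_estimate\<close>). The largest value of \<open>x y\<^sup>2\<close> on the circle is \<open>1/c\<close>, so
  \<open>Re b \<le> c (1 - e\<^sup>-\<^sup>d)\<close>.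

  Comparing the coefficients in \<open>f\<^sub>s = f\<^sub>t \<circ> \<phi>\<close> expresses \<open>b\<close> by the coefficients \<open>a(s)\<close>, \<open>a(t)\<close> of the chain:
  \<open>a(s) = e\<^sup>-\<^sup>2\<^sup>d a(t) + e\<^sup>t b\<close>. Summed over the grid \<open>0, d, 2d, \<dots>\<close> the bounds on \<open>b\<close> telescope to
  \<open>Re a(0) \<le> e\<^sup>-\<^sup>2\<^sup>n\<^sup>d Re a(nd) + c e\<^sup>d\<close>. Normality makes \<open>e\<^sup>-\<^sup>t a(t)\<close> bounded along a subsequence of
  the grid, so the first term disappears, and \<open>d \<rightarrow> 0\<close> leaves \<open>Re a(0) \<le> c\<close>. The map \<open>\<Phi>\<close> attains this
  value, and it belongs to the class because its image is starlike, which makes \<open>e\<^sup>t \<Phi>\<close> a Loewner chain.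

  One point needs care: holomorphy of \<open>\<phi>\<close>. By invariance of domain \<open>\<phi>\<close> is continuous, and by the
  inverse function theorem it is holomorphic wherever the Jacobian determinant of \<open>f\<^sub>t\<close> does not
  vanish at its value. That an injective holomorphic map has no zeros of its Jacobian is a
  theorem of Osgood, which the argument avoids: the maximum principle is applied to \<open>g\<^sup>n j\<close>, where \<open>j\<close>
  is the Jacobian along the curve, and \<open>n \<rightarrow> \<infinity>\<close> (lemma \<open>maximum_principle_off_zeros\<close>).
\<close>

section \<open>Holomorphic functions of two variables along holomorphic curves\<close>

(* Leaves the dollar sign to the components of vectors. *)
no_notation fps_nth (infixl "$" 75)

definition holomorphic_fun :: "(complex ^ 2 \<Rightarrow> complex) \<Rightarrow> (complex ^ 2) set \<Rightarrow> bool" where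
  "holomorphic_fun F U \<longleftrightarrow>
     (\<forall>z\<in>U. \<exists>D. (F has_derivative D) (at z) \<and> (\<forall>c v. D (c *s v) = c * D v))"

abbreviation pt :: "complex \<Rightarrow> complex \<Rightarrow> complex ^ 2" where
  "pt x y \<equiv> vector [x, y]"

lemma pt_components: "pt (z $ 1) (z $ 2) = z"
  by (simp add: vec_eq_iff forall_2)

lemma norm_C2: "norm (z :: complex ^ 2) = sqrt ((cmod (z $ 1))\<^sup>2 + (cmod (z $ 2))\<^sup>2)"
  by (simp add: norm_vec_def L2_set_def UNIV_2)

lemma norm_smult_axis: "norm (w *s axis j 1 :: complex ^ 2) = cmod w"
  using exhaust_2[of j] by (auto simp: norm_C2 axis_def)

lemma has_derivative_C2_iff:
  "(f has_derivative D) (at z) \<longleftrightarrow>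
     ((\<lambda>x. f x $ 1) has_derivative (\<lambda>h. D h $ 1)) (at z) \<and>
     ((\<lambda>x. f x $ 2) has_derivative (\<lambda>h. D h $ (2::2))) (at z)"
  for f :: "'a::euclidean_space \<Rightarrow> complex ^ 2"
proof
  assume "(f has_derivative D) (at z)"
  then show "((\<lambda>x. f x $ 1) has_derivative (\<lambda>h. D h $ 1)) (at z) \<and>
     ((\<lambda>x. f x $ 2) has_derivative (\<lambda>h. D h $ (2::2))) (at z)"
    by (auto intro: bounded_linear.has_derivative [OF bounded_linear_vec_nth])
next
  assume *: "((\<lambda>x. f x $ 1) has_derivative (\<lambda>h. D h $ 1)) (at z) \<and>
     ((\<lambda>x. f x $ 2) has_derivative (\<lambda>h. D h $ (2::2))) (at z)"
  have "((\<lambda>x. f x $ i) has_derivative (\<lambda>h. D h $ i)) (at z)" for i :: 2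
    using * exhaust_2[of i] by auto
  then have "((\<lambda>x. f x $ i \<bullet> u) has_derivative (\<lambda>h. D h $ i \<bullet> u)) (at z)" for i :: 2 and u
    by (rule has_derivative_inner_left)
  then show "(f has_derivative D) (at z)"
    by (subst has_derivative_componentwise_within) (auto simp: Basis_vec_def inner_axis)
qed

lemma continuous_on_C2:
  fixes f :: "'a::topological_space \<Rightarrow> complex ^ 2"
  assumes "\<And>i. continuous_on S (\<lambda>x. f x $ i)"
  shows "continuous_on S f"
proof -
  have "continuous_on S (\<lambda>x. \<chi> i. f x $ i)"
    by (intro continuous_on_vec_lambda assms)
  then show ?thesis by simp
qed

lemma has_derivative_pt:
  assumes "(a has_field_derivative a') (at \<zeta>)" "(b has_field_derivative b') (at \<zeta>)"
  shows "((\<lambda>\<zeta>. pt (a \<zeta>) (b \<zeta>)) has_derivative (\<lambda>h. h *s pt a' b')) (at \<zeta>)"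
proof -
  have "(\<lambda>h. h * c) = (*) c" for c :: complex
    by (simp add: fun_eq_iff mult.commute)
  with assms show ?thesis
    unfolding has_derivative_C2_iff by (simp add: has_field_derivative_def)
qed

lemma has_derivative_line:
  "((\<lambda>w. z + w *s e) has_derivative (\<lambda>h. h *s e)) (at (w::complex))" for z e :: "complex^2"
  unfolding has_derivative_C2_iff by (auto intro!: derivative_eq_intros)

lemma chain_rule_curve:
  fixes \<gamma> :: "complex \<Rightarrow> complex ^ 2"
  assumes \<gamma>: "(\<gamma> has_derivative (\<lambda>h. h *s e)) (at \<zeta>)"
    and F: "(F has_derivative D) (at (\<gamma> \<zeta>))" and D: "\<And>c v. D (c *s v) = c * D v"
  shows "((\<lambda>\<zeta>. F (\<gamma> \<zeta>)) has_field_derivative D e) (at \<zeta>)"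
proof -
  have "(\<lambda>h. D (h *s e)) = (*) (D e)"
    by (simp add: fun_eq_iff D mult.commute)
  with has_derivative_compose[OF \<gamma> F] show ?thesis
    by (simp add: has_field_derivative_def)
qed

lemma holomorphic_map_component:
  "holomorphic_map f U \<Longrightarrow> holomorphic_fun (\<lambda>z. f z $ i) U"
  unfolding holomorphic_map_def holomorphic_fun_def
  by (fastforce intro: bounded_linear.has_derivative[OF bounded_linear_vec_nth])

lemma holomorphic_fun_compose_curve:
  fixes \<gamma> :: "complex \<Rightarrow> complex ^ 2"
  assumes F: "holomorphic_fun F U" and "open S" and \<gamma>: "\<And>i. (\<lambda>\<zeta>. \<gamma> \<zeta> $ i) holomorphic_on S"
    and sub: "\<gamma> ` S \<subseteq> U"
  shows "(\<lambda>\<zeta>. F (\<gamma> \<zeta>)) holomorphic_on S"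
proof (rule holomorphic_onI)
  fix \<zeta> assume \<zeta>: "\<zeta> \<in> S"
  have g: "((\<lambda>\<zeta>. \<gamma> \<zeta> $ i) has_field_derivative deriv (\<lambda>\<zeta>. \<gamma> \<zeta> $ i) \<zeta>) (at \<zeta>)" for i
    by (rule holomorphic_derivI[OF \<gamma> \<open>open S\<close> \<zeta>])
  have "(\<gamma> has_derivative (\<lambda>h. h *s pt (deriv (\<lambda>\<zeta>. \<gamma> \<zeta> $ 1) \<zeta>) (deriv (\<lambda>\<zeta>. \<gamma> \<zeta> $ 2) \<zeta>))) (at \<zeta>)"
    using has_derivative_pt[OF g[of 1] g[of 2]] by (simp add: pt_components)
  moreover obtain D where "(F has_derivative D) (at (\<gamma> \<zeta>))" "\<And>c v. D (c *s v) = c * D v"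
    using F sub \<zeta> unfolding holomorphic_fun_def by (metis imageI subsetD)
  ultimately show "(\<lambda>\<zeta>. F (\<gamma> \<zeta>)) field_differentiable at \<zeta> within S"
    using chain_rule_curve field_differentiable_at_within field_differentiable_def by blast
qed

lemma holomorphic_fun_continuous_on: "holomorphic_fun F U \<Longrightarrow> continuous_on U F"
  unfolding holomorphic_fun_def
  by (meson continuous_at_imp_continuous_on has_derivative_continuous)

section \<open>Partial derivatives as locally uniform limits\<close>

text \<open>The constant depends on the function only through its bound on the disc of radius \<open>r\<close>. Applied to
  slices of a function of two variables, this makes the estimate uniform in the slice.\<close>

lemma Taylor_remainder_bound:
  fixes G :: "complex \<Rightarrow> complex"
  assumes hol: "G holomorphic_on ball 0 R" and "r < R" "0 < r"
    and B: "\<And>w. cmod w \<le> r \<Longrightarrow> cmod (G w) \<le> B" and w: "cmod w < r / 2"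
  shows "cmod (G w - (\<Sum>i\<le>n. (deriv ^^ i) G 0 * w ^ i / fact i))
    \<le> fact (Suc n) * B / (r / 2) ^ Suc n / fact n * cmod w ^ Suc n"
proof -
  have D: "(deriv ^^ i) G holomorphic_on ball 0 R" for i
    using hol by (simp add: holomorphic_higher_deriv)
  have 1: "((deriv ^^ i) G has_field_derivative (deriv ^^ Suc i) G x) (at x within ball 0 (r/2))"
    if "x \<in> ball 0 (r/2)" for i x
  proof -
    have "x \<in> ball 0 R" using that \<open>r < R\<close> \<open>0 < r\<close> by simp
    then show ?thesis
      using holomorphic_derivI[OF D open_ball, of x i] by (simp add: has_field_derivative_at_within)
  qed
  have 2: "cmod ((deriv ^^ Suc n) G x) \<le> fact (Suc n) * B / (r / 2) ^ Suc n" if x: "x \<in> ball 0 (r/2)" for x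
  proof -
    have sub: "cball x (r/2) \<subseteq> cball 0 r"
    proof
      fix y assume "y \<in> cball x (r/2)"
      then show "y \<in> cball 0 r"
        using x dist_triangle[of 0 y x] by (simp add: dist_commute)
    qed
    then have sub': "cball x (r/2) \<subseteq> ball 0 R"
      using \<open>r < R\<close> by (auto simp: subset_iff)
    show ?thesis
    proof (rule Cauchy_inequality)
      show "G holomorphic_on ball x (r/2)" "continuous_on (cball x (r/2)) G"
        using holomorphic_on_subset[OF hol sub'] holomorphic_on_imp_continuous_on
          holomorphic_on_subset[OF _ ball_subset_cball] by auto
      show "cmod (G y) \<le> B" if "cmod (x - y) = r/2" for y
      proof -
        have "y \<in> cball x (r/2)" using that by (simp add: dist_norm)
        with sub B show ?thesis by auto
      qed
    qed (use \<open>0 < r\<close> in auto)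
  qed
  have "cmod ((deriv ^^ 0) G w - (\<Sum>i\<le>n. (deriv ^^ i) G 0 * (w - 0) ^ i / fact i))
        \<le> fact (Suc n) * B / (r / 2) ^ Suc n * cmod (w - 0) ^ Suc n / fact n"
    by (rule complex_Taylor[where S = "ball 0 (r/2)", OF convex_ball 1 2]) (use w \<open>0<r\<close> in auto)
  then show ?thesis by simp
qed

lemma slice_in_ball:
  assumes "norm (z::complex^2) \<le> \<rho>" "cmod w < R" "\<rho> + R \<le> 1"
  shows "z + w *s axis j 1 \<in> B2"
  using norm_triangle_ineq[of z "w *s axis j 1"] assms by (simp add: norm_smult_axis)

lemma partial_derivative_estimate:
  assumes F: "holomorphic_fun F B2" and "\<rho> < 1" 
  obtains r C where "r > 0" "\<And>z w. norm z \<le> \<rho> \<Longrightarrow> cmod w < r \<Longrightarrow>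
     cmod (F (z + w *s axis j 1) - F z - w * complex_partial j F z) \<le> C * (cmod w)\<^sup>2"
proof -
  define R where "R = 1 - \<rho>"
  have R: "R > 0" using assms by (simp add: R_def)
  have "compact (F ` cball 0 (1 - R/2))"
    using R by (intro compact_continuous_image continuous_on_subset[OF holomorphic_fun_continuous_on[OF F]]) auto
  then obtain B where B: "\<And>z. norm z \<le> 1 - R/2 \<Longrightarrow> cmod (F z) \<le> B"
    using compact_imp_bounded bounded_iff by (metis (no_types, lifting) imageI mem_cball_0)
  show thesis
  proof (rule that[of "R/4" "2 * B / (R/2/2)\<^sup>2"])
    fix z :: "complex^2" and w assume z: "norm z \<le> \<rho>" and w: "cmod w < R/4"
    let ?G = "\<lambda>w. F (z + w *s axis j 1)"
    have "?G holomorphic_on ball 0 R"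
    proof (rule holomorphic_fun_compose_curve[OF F open_ball])
      show "(\<lambda>w. (z + w *s axis j 1) $ i) holomorphic_on ball 0 R" for i
        by (auto intro!: holomorphic_intros)
      show "(\<lambda>w. z + w *s axis j 1) ` ball 0 R \<subseteq> B2"
        using slice_in_ball[OF z, of _ R] by (auto simp: R_def simp del: mem_ball)
    qed
    moreover have "cmod (?G w) \<le> B" if "cmod w \<le> R/2" for w
    proof (rule B)
      show "norm (z + w *s axis j 1) \<le> 1 - R/2"
        using norm_triangle_ineq[of z "w *s axis j 1"] z that norm_smult_axis[of w j]
        unfolding R_def by argo
    qed
    ultimately have "cmod (?G w - (\<Sum>i\<le>1. (deriv ^^ i) ?G 0 * w ^ i / fact i))
        \<le> fact (Suc 1) * B / (R/2/2) ^ Suc 1 / fact 1 * cmod w ^ Suc 1"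
      using R w by (intro Taylor_remainder_bound[of ?G R "R/2"]) auto
    then show "cmod (F (z + w *s axis j 1) - F z - w * complex_partial j F z) \<le> 2 * B / (R/2/2)\<^sup>2 * (cmod w)\<^sup>2"
      by (simp add: complex_partial_def algebra_simps numeral_2_eq_2)
  qed (use R in auto)
qed

text \<open>Differentiability at each point says nothing on how the partial derivatives vary. As locally
  uniform limits of difference quotients they inherit continuity, and holomorphy along every
  holomorphic curve, from the function.\<close>

lemma partial_uniform_limit:
  assumes F: "holomorphic_fun F B2" and "\<rho> < 1"
  shows "uniform_limit (cball 0 \<rho>)
    (\<lambda>n z. of_nat (Suc n) * (F (z + (1 / of_nat (Suc n)) *s axis j 1) - F z)) (complex_partial j F) sequentially"
proof (rule uniform_limitI)
  fix e :: real assume e: "e > 0"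
  obtain r C where r: "r > 0" and C: "\<And>z w. norm z \<le> \<rho> \<Longrightarrow> cmod w < r \<Longrightarrow>
     cmod (F (z + w *s axis j 1) - F z - w * complex_partial j F z) \<le> C * (cmod w)\<^sup>2"
    using partial_derivative_estimate[OF assms, of j] by blast
  have lim: "(\<lambda>n. 1 / real (Suc n)) \<longlonglongrightarrow> 0" using LIMSEQ_inverse_real_of_nat by (simp add: inverse_eq_divide)
  have "\<forall>\<^sub>F n in sequentially. 1 / real (Suc n) < r"
    using order_tendstoD(2)[OF lim r] .
  moreover have "\<forall>\<^sub>F n in sequentially. 1 / real (Suc n) < e / (\<bar>C\<bar> + 1)"
    using order_tendstoD(2)[OF lim, of "e / (\<bar>C\<bar> + 1)"] e by simp
  ultimately show "\<forall>\<^sub>F n in sequentially. \<forall>z\<in>cball 0 \<rho>.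
    dist (of_nat (Suc n) * (F (z + (1 / of_nat (Suc n)) *s axis j 1) - F z)) (complex_partial j F z) < e"
  proof eventually_elim
    case (elim n)
    show ?case
    proof
      fix z :: "complex^2" assume z: "z \<in> cball 0 \<rho>"
      let ?w = "1 / of_nat (Suc n) :: complex"
      have nw: "cmod ?w = 1 / real (Suc n)" by (metis norm_divide norm_of_nat norm_one)
      have eq: "of_nat (Suc n) * (F (z + ?w *s axis j 1) - F z) - complex_partial j F z
          = of_nat (Suc n) * (F (z + ?w *s axis j 1) - F z - ?w * complex_partial j F z)"
        by (simp add: field_simps del: of_nat_Suc)
      have "cmod (of_nat (Suc n) * (F (z + ?w *s axis j 1) - F z) - complex_partial j F z)
          \<le> real (Suc n) * (C * (1 / real (Suc n))\<^sup>2)"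
        using C[of z ?w] z elim nw unfolding eq norm_mult norm_of_nat
        by (intro mult_left_mono) auto
      also have "\<dots> = C * (1 / real (Suc n))" by (simp add: power2_eq_square)
      also have "\<dots> \<le> (\<bar>C\<bar> + 1) * (1 / real (Suc n))" by (intro mult_right_mono) auto
      also have "\<dots> < e" using elim(2) by (simp add: field_simps)
      finally show "dist (of_nat (Suc n) * (F (z + ?w *s axis j 1) - F z)) (complex_partial j F z) < e"
        by (simp add: dist_norm)
    qed
  qed
qed

lemma slice_point_in_ball: "cmod w < 1 - norm z \<Longrightarrow> z + w *s axis j 1 \<in> B2"
  by (rule slice_in_ball[of z "norm z" w "1 - norm z"]) auto

lemma complex_partial_continuous:
  assumes F: "holomorphic_fun F B2"
  shows "continuous_on B2 (complex_partial j F)"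
proof (rule continuous_at_imp_continuous_on, safe)
  fix z assume z: "z \<in> B2"
  define \<rho> where "\<rho> = (1 + norm z) / 2"
  have \<rho>: "norm z < \<rho>" "\<rho> < 1" using z by (auto simp: \<rho>_def)
  \<comment> \<open>From the index \<open>N\<close> on, the difference quotients evaluate \<open>F\<close> inside the ball only.\<close>
  obtain N where N: "1 / real (Suc N) < 1 - \<rho>"
    using reals_Archimedean[of "1 - \<rho>"] \<rho> by (auto simp: inverse_eq_divide)
  have "continuous_on (cball 0 \<rho>) (complex_partial j F)"
  proof (rule uniform_limit_theorem[OF _ partial_uniform_limit[OF F \<rho>(2)]])
    show "\<forall>\<^sub>F n in sequentially. continuous_on (cball 0 \<rho>)
      (\<lambda>z. of_nat (Suc n) * (F (z + (1 / of_nat (Suc n)) *s axis j 1) - F z))"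
    proof (rule eventually_sequentiallyI[of N])
      fix n assume "N \<le> n"
      then have "1 / real (Suc n) \<le> 1 / real (Suc N)" by (simp add: frac_le)
      then have n: "cmod (1 / of_nat (Suc n)) < 1 - \<rho>"
        using N by (simp add: norm_divide del: of_nat_Suc)
      have sub: "(\<lambda>z. z + (1 / of_nat (Suc n)) *s axis j 1) ` cball 0 \<rho> \<subseteq> B2"
        using n by (auto intro!: slice_point_in_ball simp del: mem_ball)
      show "continuous_on (cball 0 \<rho>)
        (\<lambda>z. of_nat (Suc n) * (F (z + (1 / of_nat (Suc n)) *s axis j 1) - F z))"
        using \<rho>(2) sub
        by (intro continuous_intros continuous_on_compose2[OF holomorphic_fun_continuous_on[OF F]]) auto
    qed
  qed auto
  then show "isCont (complex_partial j F) z"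
    using \<rho>(1) by (auto intro: continuous_on_interior)
qed

lemma complex_partial_compose_curve:
  fixes \<gamma> :: "complex \<Rightarrow> complex ^ 2"
  assumes F: "holomorphic_fun F B2" and S: "open S" and \<gamma>: "\<And>i. (\<lambda>\<zeta>. \<gamma> \<zeta> $ i) holomorphic_on S"
    and sub: "\<gamma> ` S \<subseteq> B2"
  shows "(\<lambda>\<zeta>. complex_partial j F (\<gamma> \<zeta>)) holomorphic_on S"
proof (rule holomorphic_onI)
  fix \<zeta> assume "\<zeta> \<in> S"
  then obtain d where d: "d > 0" "cball \<zeta> d \<subseteq> S" using S open_contains_cball by blast
  have cont: "continuous_on S \<gamma>"
    by (rule continuous_on_C2) (rule holomorphic_on_imp_continuous_on[OF \<gamma>])
  have "compact (\<gamma> ` cball \<zeta> d)"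
    using cont d by (intro compact_continuous_image continuous_on_subset[OF cont]) auto
  then have "compact (norm ` \<gamma> ` cball \<zeta> d)"
    by (rule compact_continuous_image[OF continuous_on_norm[OF continuous_on_id]])
  then obtain \<xi> where \<xi>: "\<xi> \<in> cball \<zeta> d" "\<And>x. x \<in> cball \<zeta> d \<Longrightarrow> norm (\<gamma> x) \<le> norm (\<gamma> \<xi>)"
    using compact_attains_sup[of "norm ` \<gamma> ` cball \<zeta> d"] d(1) by (auto simp del: mem_cball)
  define \<rho> where "\<rho> = norm (\<gamma> \<xi>)"
  have "\<gamma> \<xi> \<in> B2" using \<xi>(1) d(2) sub by blast
  with \<xi>(2) have \<rho>: "\<rho> < 1" "\<And>x. x \<in> cball \<zeta> d \<Longrightarrow> norm (\<gamma> x) \<le> \<rho>"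
    by (simp_all add: \<rho>_def)
  \<comment> \<open>From the index \<open>N\<close> on, the difference quotients evaluate \<open>F\<close> inside the ball only.\<close>
  obtain N where N: "1 / real (Suc N) < 1 - \<rho>"
    using reals_Archimedean[of "1 - \<rho>"] \<rho> by (auto simp: inverse_eq_divide)
  let ?q = "\<lambda>n z. of_nat (Suc n) * (F (z + (1 / of_nat (Suc n)) *s axis j 1) - F z)"
  have "uniform_limit (cball 0 \<rho>) (\<lambda>n. ?q (n + N)) (complex_partial j F) sequentially"
    using partial_uniform_limit[OF F \<rho>(1)]
    by (rule filterlim_compose[OF _ filterlim_add_const_nat_at_top])
  then have ul: "uniform_limit (cball \<zeta> d) (\<lambda>n \<zeta>. ?q (n + N) (\<gamma> \<zeta>)) (\<lambda>\<zeta>. complex_partial j F (\<gamma> \<zeta>)) sequentially"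
    by (rule uniform_limit_compose') (use \<rho> in auto)
  have "(\<lambda>\<zeta>. complex_partial j F (\<gamma> \<zeta>)) holomorphic_on ball \<zeta> d"
  proof (rule holomorphic_uniform_sequence[OF open_ball, where f = "\<lambda>n \<zeta>. ?q (n + N) (\<gamma> \<zeta>)"])
    fix n
    have "1 / real (Suc (n + N)) \<le> 1 / real (Suc N)" by (simp add: frac_le)
    then have n: "cmod (1 / of_nat (Suc (n + N))) < 1 - \<rho>"
      using N by (simp add: norm_divide del: of_nat_Suc)
    have g: "(\<lambda>\<zeta>. \<gamma> \<zeta> $ i) holomorphic_on ball \<zeta> d" for i
      using \<gamma>[of i] d(2) holomorphic_on_subset ball_subset_cball by blast
    have "(\<lambda>\<zeta>. F (\<gamma> \<zeta> + (1 / of_nat (Suc (n + N))) *s axis j 1)) holomorphic_on ball \<zeta> d"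
    proof (rule holomorphic_fun_compose_curve[OF F open_ball])
      show "(\<lambda>\<zeta>. (\<gamma> \<zeta> + (1 / of_nat (Suc (n + N))) *s axis j 1) $ i) holomorphic_on ball \<zeta> d" for i
        using g[of i] by (auto intro!: holomorphic_intros)
      show "(\<lambda>\<zeta>. \<gamma> \<zeta> + (1 / of_nat (Suc (n + N))) *s axis j 1) ` ball \<zeta> d \<subseteq> B2"
      proof (rule image_subsetI)
        fix x assume "x \<in> ball \<zeta> d"
        then have "x \<in> cball \<zeta> d" by simp
        from slice_in_ball[OF \<rho>(2)[OF this] n] show "\<gamma> x + (1 / of_nat (Suc (n + N))) *s axis j 1 \<in> B2"
          by simp
      qed
    qed
    moreover have "(\<lambda>\<zeta>. F (\<gamma> \<zeta>)) holomorphic_on ball \<zeta> d"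
    proof (rule holomorphic_fun_compose_curve[OF F open_ball g])
      have "ball \<zeta> d \<subseteq> S" using d(2) ball_subset_cball by blast
      then show "\<gamma> ` ball \<zeta> d \<subseteq> B2" using sub by blast
    qed
    ultimately show "(\<lambda>\<zeta>. ?q (n + N) (\<gamma> \<zeta>)) holomorphic_on ball \<zeta> d"
      by (intro holomorphic_intros)
  next
    fix x assume "x \<in> ball \<zeta> d"
    then obtain e where e: "e > 0" "cball x e \<subseteq> ball \<zeta> d" using open_contains_cball open_ball by blast
    have "uniform_limit (cball x e) (\<lambda>n \<zeta>. ?q (n + N) (\<gamma> \<zeta>)) (\<lambda>\<zeta>. complex_partial j F (\<gamma> \<zeta>)) sequentially"
      by (rule uniform_limit_on_subset[OF ul]) (use e in auto)
    with e show "\<exists>e>0. cball x e \<subseteq> ball \<zeta> d \<and>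
      uniform_limit (cball x e) (\<lambda>n \<zeta>. ?q (n + N) (\<gamma> \<zeta>)) (\<lambda>\<zeta>. complex_partial j F (\<gamma> \<zeta>)) sequentially"
      by blast
  qed
  then show "(\<lambda>\<zeta>. complex_partial j F (\<gamma> \<zeta>)) field_differentiable at \<zeta> within S"
    using d(1) by (metis centre_in_ball field_differentiable_at_within holomorphic_on_imp_differentiable_at open_ball)
qed

section \<open>The second coefficient along a weighted curve\<close>

lemma complex_partial_eq_derivative:
  assumes "(F has_derivative D) (at z)" "\<And>c v. D (c *s v) = c * D v"
  shows "complex_partial j F z = D (axis j 1)"
proof -
  have "((\<lambda>w. F (z + w *s axis j 1)) has_field_derivative D (axis j 1)) (at 0)"
    using assms by (intro chain_rule_curve[OF has_derivative_line]) auto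
  then show ?thesis by (simp add: complex_partial_def DERIV_imp_deriv)
qed

lemma complex_partial_twice_at_0:
  "complex_partial j (complex_partial j F) 0 = (deriv ^^ 2) (\<lambda>w. F (w *s axis j 1)) 0"
proof -
  have "complex_partial j F (w *s axis j 1) = deriv (\<lambda>w. F (w *s axis j 1)) w" for w
    unfolding complex_partial_def
    by (subst deriv_shift_0[of _ w]) (simp add: o_def vector_sadd_rdistrib)
  then show ?thesis
    by (simp add: complex_partial_def[of j "complex_partial j F"] numeral_2_eq_2)
qed

lemma slice_holomorphic:
  assumes F: "holomorphic_fun F B2"
  shows "(\<lambda>w. F (w *s axis j 1)) holomorphic_on ball 0 1"
proof (rule holomorphic_fun_compose_curve[OF F open_ball])
  show "(\<lambda>w. (w *s axis j 1) $ i) holomorphic_on ball 0 1" for i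
    by (auto intro!: holomorphic_intros)
  show "(\<lambda>w. w *s axis j 1) ` ball 0 1 \<subseteq> B2"
    using slice_in_ball[of 0 0 _ 1 j] by (auto simp del: mem_ball simp: mem_ball[where 'a=complex])
qed

text \<open>Along a curve with \<open>z\<^sub>1 \<sim> u\<^sub>2 \<zeta>\<^sup>2\<close> and \<open>z\<^sub>2 \<sim> v\<^sub>1 \<zeta>\<close> the only monomials of order at most two are \<open>z\<^sub>1\<close>, \<open>z\<^sub>2\<close>
  and \<open>z\<^sub>2\<^sup>2\<close>, and the hypothesis on the derivative removes \<open>z\<^sub>2\<close>. This is the chain rule for the
  coefficient of \<open>z\<^sub>2\<^sup>2\<close>: it is applied to both sides of \<open>h \<circ> \<gamma> = f \<circ> P\<close>.\<close>

lemma second_coefficient_along_curve: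
  assumes F: "holomorphic_fun F B2" and F0: "F 0 = 0"
    and DF: "(F has_derivative (\<lambda>v. l * v $ 1)) (at 0)"
    and u: "(\<lambda>\<zeta>. u \<zeta> / \<zeta>\<^sup>2) \<midarrow>0\<rightarrow> u2" and v: "(\<lambda>\<zeta>. v \<zeta> / \<zeta>) \<midarrow>0\<rightarrow> v1"
  shows "(\<lambda>\<zeta>. F (pt (u \<zeta>) (v \<zeta>)) / \<zeta>\<^sup>2) \<midarrow>0\<rightarrow>
    l * u2 + 1 / 2 * complex_partial 2 (complex_partial 2 F) 0 * v1\<^sup>2"
proof -
  let ?G = "\<lambda>w. F (w *s axis 2 1)"
  define a where "a = 1 / 2 * complex_partial 2 (complex_partial 2 F) 0"
  have nz: "\<forall>\<^sub>F \<zeta> in at 0. \<zeta> \<noteq> (0::complex)" by (simp add: eventually_at_filter)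
  have u0: "u \<midarrow>0\<rightarrow> 0"
  proof -
    have "(\<lambda>\<zeta>. u \<zeta> / \<zeta>\<^sup>2 * \<zeta>\<^sup>2) \<midarrow>0\<rightarrow> u2 * 0\<^sup>2"
      by (intro tendsto_intros u)
    then have "(\<lambda>\<zeta>. u \<zeta> / \<zeta>\<^sup>2 * \<zeta>\<^sup>2) \<midarrow>0\<rightarrow> 0" by simp
    then show ?thesis
      by (rule Lim_transform_eventually) (use nz in eventually_elim, simp)
  qed
  have v0: "v \<midarrow>0\<rightarrow> 0"
  proof -
    have "(\<lambda>\<zeta>. v \<zeta> / \<zeta> * \<zeta>) \<midarrow>0\<rightarrow> v1 * 0"
      by (intro tendsto_intros v)
    then have "(\<lambda>\<zeta>. v \<zeta> / \<zeta> * \<zeta>) \<midarrow>0\<rightarrow> 0" by simp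
    then show ?thesis
      by (rule Lim_transform_eventually) (use nz in eventually_elim, simp)
  qed
  \<comment> \<open>The direction transversal to the \<open>z\<^sub>2\<close>-axis contributes only through the first order term.\<close>
  obtain r C where r: "r > 0" and C: "\<And>z w. norm z \<le> 1/2 \<Longrightarrow> cmod w < r \<Longrightarrow>
     cmod (F (z + w *s axis 1 1) - F z - w * complex_partial 1 F z) \<le> C * (cmod w)\<^sup>2"
    using partial_derivative_estimate[OF F, of "1/2" 1] by auto
  define E where "E \<zeta> = F (pt (u \<zeta>) (v \<zeta>)) - ?G (v \<zeta>) - u \<zeta> * complex_partial 1 F (v \<zeta> *s axis 2 1)" for \<zeta>
  have "\<forall>\<^sub>F \<zeta> in at 0. cmod (u \<zeta>) < r" "\<forall>\<^sub>F \<zeta> in at 0. cmod (v \<zeta>) < 1/2"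
    using order_tendstoD(2)[OF tendsto_norm_zero[OF u0] r]
      order_tendstoD(2)[OF tendsto_norm_zero[OF v0], of "1/2"] by auto
  then have E: "\<forall>\<^sub>F \<zeta> in at 0. cmod (E \<zeta> / \<zeta>\<^sup>2) \<le> cmod (C * (u \<zeta> / \<zeta>\<^sup>2 * u \<zeta>))"
  proof eventually_elim
    case (elim \<zeta>)
    have "norm (v \<zeta> *s axis 2 1 :: complex^2) \<le> 1/2"
      using elim by (simp add: norm_C2 axis_def)
    moreover have "pt (u \<zeta>) (v \<zeta>) = v \<zeta> *s axis 2 1 + u \<zeta> *s axis 1 1"
      by (simp add: vec_eq_iff forall_2 axis_def)
    ultimately have "cmod (E \<zeta>) \<le> C * (cmod (u \<zeta>))\<^sup>2"
      using C[of "v \<zeta> *s axis 2 1" "u \<zeta>"] elim by (simp add: E_def)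
    also have "\<dots> \<le> \<bar>C\<bar> * (cmod (u \<zeta>))\<^sup>2" by (intro mult_right_mono) auto
    finally show ?case
      by (simp add: norm_divide norm_mult norm_power power2_eq_square divide_right_mono)
  qed
  have "(\<lambda>\<zeta>. C * (u \<zeta> / \<zeta>\<^sup>2 * u \<zeta>)) \<midarrow>0\<rightarrow> C * (u2 * 0)"
    by (intro tendsto_intros u u0)
  then have "(\<lambda>\<zeta>. C * (u \<zeta> / \<zeta>\<^sup>2 * u \<zeta>)) \<midarrow>0\<rightarrow> 0" by simp
  then have E0: "(\<lambda>\<zeta>. E \<zeta> / \<zeta>\<^sup>2) \<midarrow>0\<rightarrow> 0"
    by (rule tendsto_0_le[where K = 1]) (use E in eventually_elim, simp)
  have "complex_partial 1 F 0 = l"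
    using complex_partial_eq_derivative[OF DF, of 1] by (simp add: algebra_simps)
  moreover have "isCont (complex_partial 1 F) 0"
    using complex_partial_continuous[OF F] by (simp add: continuous_on_eq_continuous_at)
  moreover have "(\<lambda>\<zeta>. v \<zeta> *s axis 2 1) \<midarrow>0\<rightarrow> (0 :: complex ^ 2)"
  proof (rule vec_tendstoI)
    show "(\<lambda>\<zeta>. (v \<zeta> *s axis 2 1 :: complex ^ 2) $ i) \<midarrow>0\<rightarrow> 0 $ i" for i
      using tendsto_mult[OF v0 tendsto_const[of "axis 2 1 $ i"]] by simp
  qed
  ultimately have d: "(\<lambda>\<zeta>. complex_partial 1 F (v \<zeta> *s axis 2 1)) \<midarrow>0\<rightarrow> l"
    using isCont_tendsto_compose[of 0 "complex_partial 1 F"] by simp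
  \<comment> \<open>Along the \<open>z\<^sub>2\<close>-axis the function starts with its quadratic term.\<close>
  have hol: "?G holomorphic_on ball 0 1" by (rule slice_holomorphic[OF F])
  have "compact (?G ` cball 0 (1/2))"
    by (intro compact_continuous_image continuous_on_subset[OF holomorphic_on_imp_continuous_on[OF hol]]) auto
  then obtain B where B: "\<And>w. cmod w \<le> 1/2 \<Longrightarrow> cmod (?G w) \<le> B"
    using compact_imp_bounded bounded_iff by (metis (no_types, lifting) imageI mem_cball_0)
  define K where "K = fact (Suc 2) * B / (1/2/2) ^ Suc 2 / fact 2"
  have G1: "deriv ?G 0 = 0"
    using complex_partial_eq_derivative[OF DF, of 2] by (simp add: complex_partial_def axis_def algebra_simps)
  have a: "(deriv ^^ 2) ?G 0 = 2 * a"
    by (simp add: a_def complex_partial_twice_at_0)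
  have Tay: "cmod (?G w - a * w\<^sup>2) \<le> K * cmod w ^ 3" if "cmod w < 1/4" for w
  proof -
    have "cmod (?G w - (\<Sum>i\<le>2. (deriv ^^ i) ?G 0 * w ^ i / fact i)) \<le> K * cmod w ^ Suc 2"
      unfolding K_def using that by (intro Taylor_remainder_bound[OF hol _ _ B]) auto
    moreover have "(\<Sum>i\<le>2. (deriv ^^ i) ?G 0 * w ^ i / fact i) = a * w\<^sup>2"
      using a G1 F0 by (simp add: numeral_2_eq_2)
    ultimately show ?thesis by (simp add: numeral_3_eq_3 numeral_2_eq_2)
  qed
  have "\<forall>\<^sub>F \<zeta> in at 0. cmod (v \<zeta>) < 1/4"
    using order_tendstoD(2)[OF tendsto_norm_zero[OF v0], of "1/4"] by auto
  then have H: "\<forall>\<^sub>F \<zeta> in at 0. cmod ((?G (v \<zeta>) - a * (v \<zeta>)\<^sup>2) / \<zeta>\<^sup>2) \<le> cmod (K * ((v \<zeta> / \<zeta>)\<^sup>2 * v \<zeta>))"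
  proof eventually_elim
    case (elim \<zeta>)
    have "cmod (?G (v \<zeta>) - a * (v \<zeta>)\<^sup>2) \<le> \<bar>K\<bar> * cmod (v \<zeta>) ^ 3"
      by (rule order_trans[OF Tay[OF elim] mult_right_mono]) auto
    then show ?case
      by (simp add: norm_divide norm_mult norm_power power_divide power2_eq_square power3_eq_cube
          divide_right_mono mult.assoc)
  qed
  have "(\<lambda>\<zeta>. K * ((v \<zeta> / \<zeta>)\<^sup>2 * v \<zeta>)) \<midarrow>0\<rightarrow> K * (v1\<^sup>2 * 0)"
    by (intro tendsto_intros v v0)
  then have "(\<lambda>\<zeta>. K * ((v \<zeta> / \<zeta>)\<^sup>2 * v \<zeta>)) \<midarrow>0\<rightarrow> 0" by simp
  then have H0: "(\<lambda>\<zeta>. (?G (v \<zeta>) - a * (v \<zeta>)\<^sup>2) / \<zeta>\<^sup>2) \<midarrow>0\<rightarrow> 0"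
    by (rule tendsto_0_le[where K = 1]) (use H in eventually_elim, simp)
  have "(\<lambda>\<zeta>. E \<zeta> / \<zeta>\<^sup>2 + (?G (v \<zeta>) - a * (v \<zeta>)\<^sup>2) / \<zeta>\<^sup>2 + a * (v \<zeta> / \<zeta>)\<^sup>2
      + complex_partial 1 F (v \<zeta> *s axis 2 1) * (u \<zeta> / \<zeta>\<^sup>2)) \<midarrow>0\<rightarrow> 0 + 0 + a * v1\<^sup>2 + l * u2"
    by (intro tendsto_intros E0 H0 u v d)
  then have "(\<lambda>\<zeta>. F (pt (u \<zeta>) (v \<zeta>)) / \<zeta>\<^sup>2) \<midarrow>0\<rightarrow> 0 + 0 + a * v1\<^sup>2 + l * u2"
    by (rule Lim_transform_eventually)
      (use nz in eventually_elim, simp add: E_def field_simps power_divide)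
  then show ?thesis by (simp add: a_def add.commute)
qed

section \<open>The estimate for transition maps\<close>

text \<open>A maximum principle for a function that is holomorphic only off the zeros of \<open>j\<close>. The product
  \<open>g\<^sup>n j\<close> vanishes on the part of the boundary where \<open>g\<close> is not controlled, so \<open>|g(\<xi>)|\<^sup>n |j(\<xi>)| \<le> M\<^sup>n sup |j|\<close>,
  and the factor \<open>j\<close> disappears on taking \<open>n\<close>-th roots.\<close>

lemma maximum_principle_off_zeros:
  fixes g j :: "complex \<Rightarrow> complex"
  assumes cont: "continuous_on (cball 0 \<rho>) g" "continuous_on (cball 0 \<rho>) j"
    and hol: "g holomorphic_on {\<zeta>\<in>ball 0 \<rho>. j \<zeta> \<noteq> 0}" "j holomorphic_on {\<zeta>\<in>ball 0 \<rho>. j \<zeta> \<noteq> 0}"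
    and \<xi>: "\<xi> \<in> ball 0 \<rho>" "j \<xi> \<noteq> 0"
    and M: "\<And>\<zeta>. cmod \<zeta> = \<rho> \<Longrightarrow> cmod (g \<zeta>) \<le> M" and "0 < M"
  shows "cmod (g \<xi>) \<le> M"
proof (rule ccontr)
  assume "\<not> cmod (g \<xi>) \<le> M"
  then have big: "1 < cmod (g \<xi>) / M" using \<open>0 < M\<close> by simp
  let ?S = "{\<zeta>\<in>ball 0 \<rho>. j \<zeta> \<noteq> 0}"
  have "continuous_on (ball 0 \<rho>) j" using cont(2) continuous_on_subset ball_subset_cball by blast
  from continuous_open_preimage[OF this open_ball, of "- {0}"] have "open ?S"
    by (simp add: Int_def vimage_def open_Compl)
  have clo: "closure ?S \<subseteq> cball 0 \<rho>"
    by (rule closure_minimal) auto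
  obtain J where J: "\<And>\<zeta>. \<zeta> \<in> cball 0 \<rho> \<Longrightarrow> cmod (j \<zeta>) \<le> J"
    using compact_imp_bounded[OF compact_continuous_image[OF cont(2) compact_cball]] unfolding bounded_iff by blast
  have "(cmod (g \<xi>) / M) ^ n \<le> J / cmod (j \<xi>)" for n
  proof -
    have "cmod (g \<xi> ^ n * j \<xi>) \<le> M ^ n * J"
    proof (rule maximum_modulus_frontier[where f = "\<lambda>\<zeta>. g \<zeta> ^ n * j \<zeta>" and S = ?S])
      show "(\<lambda>\<zeta>. g \<zeta> ^ n * j \<zeta>) holomorphic_on interior ?S"
        using hol \<open>open ?S\<close> by (simp add: interior_open holomorphic_intros)
      show "continuous_on (closure ?S) (\<lambda>\<zeta>. g \<zeta> ^ n * j \<zeta>)"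
        using cont clo by (intro continuous_intros) (auto intro: continuous_on_subset)
      show "bounded ?S" by (rule bounded_subset[OF bounded_ball[of 0 \<rho>]]) auto
      show "\<xi> \<in> ?S" using \<xi> by simp
      fix z assume "z \<in> frontier ?S"
      then have z: "z \<in> cball 0 \<rho>" "z \<notin> ?S"
        using clo \<open>open ?S\<close> by (auto simp: frontier_def interior_open)
      have "0 \<le> J" using J[OF z(1)] norm_ge_zero order_trans by blast
      show "cmod (g z ^ n * j z) \<le> M ^ n * J"
      proof (cases "j z = 0")
        case True
        then show ?thesis using \<open>0 < M\<close> \<open>0 \<le> J\<close> by simp
      next
        case False
        with z have "cmod z = \<rho>" by auto
        with M have "cmod (g z) \<le> M" by blast
        then show ?thesis
          unfolding norm_mult norm_power using J[OF z(1)] \<open>0 < M\<close> by (intro mult_mono power_mono) auto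
      qed
    qed
    then show ?thesis
      using \<open>0 < M\<close> \<xi>(2) by (simp add: norm_mult norm_power field_simps)
  qed
  then show False
    using real_arch_pow[OF big, of "J / cmod (j \<xi>)"] by (meson not_less)
qed

definition jacobian :: "(complex ^ 2 \<Rightarrow> complex ^ 2) \<Rightarrow> complex ^ 2 \<Rightarrow> complex" where
  "jacobian f z =
     complex_partial 1 (\<lambda>z. f z $ 1) z * complex_partial 2 (\<lambda>z. f z $ 2) z -
     complex_partial 2 (\<lambda>z. f z $ 1) z * complex_partial 1 (\<lambda>z. f z $ 2) z"

lemma complex_partial_component:
  assumes "(f has_derivative D) (at z)" "\<And>c v. D (c *s v) = c *s D v"
  shows "complex_partial j (\<lambda>z. f z $ i) z = D (axis j 1) $ i"
  using assms
  by (intro complex_partial_eq_derivative) (auto intro: bounded_linear.has_derivative[OF bounded_linear_vec_nth])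

lemma univalent_continuous_on: "univalent f \<Longrightarrow> continuous_on B2 f"
  unfolding univalent_def holomorphic_map_def
  by (meson continuous_at_imp_continuous_on has_derivative_continuous)

text \<open>By invariance of domain the inverse is continuous, and a continuous inverse is differentiable at
  \<open>f z\<close> once the derivative of \<open>f\<close> at \<open>z\<close> is invertible. Its derivative inherits complex linearity.\<close>

lemma inverse_has_derivative:
  assumes f: "univalent f" and z: "z \<in> B2" and jac: "jacobian f z \<noteq> 0"
    and D: "(f has_derivative D) (at z)" "\<And>c v. D (c *s v) = c *s D v"
  obtains E where "(inv_into B2 f has_derivative E) (at (f z))" "\<And>c v. E (c *s v) = c *s E v"
    "\<And>v. D (E v) = v"
proof -
  have lin: "linear D" using D(1) by (rule has_derivative_linear)
  have "v = 0" if "D v = 0" for v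
  proof -
    have "v = v $ 1 *s axis 1 1 + v $ 2 *s axis 2 1"
      by (simp add: vec_eq_iff forall_2 axis_def)
    then have "D v = v $ 1 *s D (axis 1 1) + v $ 2 *s D (axis 2 1)"
      using D(2) linear_add[OF lin] by metis
    then have eq: "v $ 1 * D (axis 1 1) $ i + v $ 2 * D (axis 2 1) $ i = 0" for i
      using that by (metis vector_add_component vector_smult_component zero_index)
    have j: "D (axis 1 1) $ 1 * D (axis 2 1) $ 2 - D (axis 2 1) $ 1 * D (axis 1 1) $ 2 \<noteq> 0"
      using jac unfolding jacobian_def complex_partial_component[OF D] .
    have "(D (axis 1 1) $ 1 * D (axis 2 1) $ 2 - D (axis 2 1) $ 1 * D (axis 1 1) $ 2) * v $ 1 = 0"
      "(D (axis 1 1) $ 1 * D (axis 2 1) $ 2 - D (axis 2 1) $ 1 * D (axis 1 1) $ 2) * v $ 2 = 0"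
      using eq[of 1] eq[of 2] by algebra+
    with j show "v = 0" by (simp add: vec_eq_iff forall_2)
  qed
  then have "inj D" using linear_injective_0[OF lin] by blast
  then obtain E where E: "\<And>v. E (D v) = v" "\<And>v. D (E v) = v"
    using linear_injective_isomorphism[OF lin] by blast
  show thesis
  proof (rule that)
    show "(inv_into B2 f has_derivative E) (at (f z))"
      using f z by (intro has_derivative_inverse_strong[OF open_ball z univalent_continuous_on[OF f] _ D(1)])
        (auto simp: univalent_def E fun_eq_iff)
    show "E (c *s v) = c *s E v" for c v
      by (metis E D(2))
  qed (rule E)
qed

text \<open>Used twice to divide the first component of the curve by \<open>\<zeta>\<^sup>2\<close>, and once to divide the second by \<open>\<zeta>\<close>.\<close>

lemma difference_quotient_holomorphic:
  fixes k :: "complex \<Rightarrow> complex"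
  assumes "k holomorphic_on S" "open S" "0 \<in> S" "k 0 = 0"
  shows "(\<lambda>\<zeta>. if \<zeta> = 0 then deriv k 0 else k \<zeta> / \<zeta>) holomorphic_on S"
  using pole_lemma_open[OF assms(1,2), of 0] assms(4) by (simp cong: if_cong)

text \<open>The core of the proof. With \<open>p = e\<^sup>s\<close> and \<open>q = e\<^sup>t\<close> the number inside the modulus is the value at 0 of the
  function \<open>g = x \<phi>\<^sub>1 / \<zeta>\<^sup>2 + y \<phi>\<^sub>2 / \<zeta>\<close> along the weighted disc \<open>P\<close>, for the transition map \<open>\<phi> = h\<^sup>-\<^sup>1 \<circ> f\<close>. The
  factor multiplying \<open>x y\<^sup>2\<close> is the coefficient of \<open>z\<^sub>2\<^sup>2\<close> in \<open>\<phi>\<^sub>1\<close>, written in terms of \<open>f\<close> and \<open>h\<close>.\<close>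

lemma transition_estimate:
  assumes f: "univalent f" "f 0 = 0" "(f has_derivative (\<lambda>v. p *\<^sub>R v)) (at 0)"
    and h: "univalent h" "h 0 = 0" "(h has_derivative (\<lambda>v. q *\<^sub>R v)) (at 0)"
    and sub: "f ` B2 \<subseteq> h ` B2" and q: "q \<noteq> 0" and xy: "x\<^sup>2 + y\<^sup>2 = (1::real)"
  shows "cmod (complex_of_real (p / q) + complex_of_real (x * y\<^sup>2 / q) *
    (L1_02 f - complex_of_real ((p / q)\<^sup>2) * L1_02 h)) \<le> 1"
proof -
  define P where "P \<zeta> = pt (x * \<zeta>\<^sup>2) (y * \<zeta>)" for \<zeta> :: complex
  define \<gamma> where "\<gamma> \<zeta> = inv_into B2 h (f (P \<zeta>))" for \<zeta> :: complex
  define j where "j \<zeta> = jacobian h (\<gamma> \<zeta>)" for \<zeta> :: complex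
  define S where "S = {\<zeta> \<in> ball 0 1. j \<zeta> \<noteq> 0}"
  have hh: "holomorphic_map h B2" "inj_on h B2" and hf: "holomorphic_map f B2"
    using h f by (auto simp: univalent_def)
  have PB: "P \<zeta> \<in> B2" if "\<zeta> \<in> ball 0 1" for \<zeta> :: complex
  proof -
    have c: "(cmod \<zeta>)\<^sup>2 < 1" using that by (simp add: abs_square_less_1)
    have "(cmod (x * \<zeta>\<^sup>2))\<^sup>2 + (cmod (y * \<zeta>))\<^sup>2 = (x\<^sup>2 * (cmod \<zeta>)\<^sup>2 + y\<^sup>2) * (cmod \<zeta>)\<^sup>2"
      by (simp add: norm_mult norm_power power_mult_distrib power2_eq_square algebra_simps)
    also have "\<dots> \<le> (x\<^sup>2 * 1 + y\<^sup>2) * (cmod \<zeta>)\<^sup>2"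
      using c by (intro mult_right_mono add_mono mult_left_mono) auto
    also have "\<dots> < 1" using c xy by simp
    finally show ?thesis by (simp add: P_def norm_C2)
  qed
  have P': "(P has_derivative (\<lambda>w. w *s pt (2 * x * \<zeta>) y)) (at \<zeta>)" for \<zeta> :: complex
    unfolding P_def by (rule has_derivative_pt) (auto intro!: derivative_eq_intros)
  have \<gamma>B: "\<gamma> \<zeta> \<in> B2" and h\<gamma>: "h (\<gamma> \<zeta>) = f (P \<zeta>)" if "\<zeta> \<in> ball 0 1" for \<zeta> :: complex
  proof -
    have "f (P \<zeta>) \<in> h ` B2" using PB[OF that] sub by blast
    then show "\<gamma> \<zeta> \<in> B2" "h (\<gamma> \<zeta>) = f (P \<zeta>)"
      unfolding \<gamma>_def by (rule inv_into_into, rule f_inv_into_f)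
  qed
  have P0: "P 0 = 0" by (simp add: P_def vec_eq_iff forall_2)
  have \<gamma>0: "\<gamma> 0 = 0"
    using hh(2) f(2) h(2) P0 by (metis \<gamma>_def centre_in_ball inv_into_f_f zero_less_one)
  have cont_inv: "continuous_on (h ` B2) (inv_into B2 h)"
    using hh(2) by (intro continuous_on_inverse_open univalent_continuous_on[OF h(1)]) auto
  have contP: "continuous_on (ball 0 1) P"
    using P' by (meson continuous_at_imp_continuous_on has_derivative_continuous)
  have cont_fP: "continuous_on (ball 0 1) (\<lambda>\<zeta>. f (P \<zeta>))"
    by (rule continuous_on_compose2[OF univalent_continuous_on[OF f(1)] contP]) (use PB in blast)
  have cont\<gamma>: "continuous_on (ball 0 1) \<gamma>"
    unfolding \<gamma>_def by (rule continuous_on_compose2[OF cont_inv cont_fP]) (use PB sub in blast)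
  have contj: "continuous_on (ball 0 1) j"
    unfolding j_def jacobian_def
    by (intro continuous_intros continuous_on_compose2[OF complex_partial_continuous cont\<gamma>]
        holomorphic_map_component hh) (use \<gamma>B in blast)+
  have "open S"
    using continuous_open_preimage[OF contj open_ball, of "- {0}"]
    by (simp add: S_def Int_def vimage_def open_Compl)
  have SB: "S \<subseteq> ball 0 1" by (auto simp: S_def)
  have \<gamma>': "\<exists>E D. (\<forall>i. ((\<lambda>\<zeta>. \<gamma> \<zeta> $ i) has_field_derivative E (Df (pt (2 * x * \<zeta>) y)) $ i) (at \<zeta>))
        \<and> (h has_derivative D) (at (\<gamma> \<zeta>)) \<and> (\<forall>v. D (E v) = v)"
    if \<zeta>: "\<zeta> \<in> S" and Df: "(f has_derivative Df) (at (P \<zeta>))" "\<And>c v. Df (c *s v) = c *s Df v" for \<zeta> :: complex and Df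
  proof -
    have \<zeta>B: "\<zeta> \<in> ball 0 1" and jac: "jacobian h (\<gamma> \<zeta>) \<noteq> 0" using \<zeta> by (auto simp: S_def j_def)
    obtain D where D: "(h has_derivative D) (at (\<gamma> \<zeta>))" "\<And>c v. D (c *s v) = c *s D v"
      using hh(1) \<gamma>B[OF \<zeta>B] unfolding holomorphic_map_def by blast
    obtain E where E: "(inv_into B2 h has_derivative E) (at (f (P \<zeta>)))" "\<And>c v. E (c *s v) = c *s E v"
      "\<And>v. D (E v) = v"
      using inverse_has_derivative[OF h(1) \<gamma>B[OF \<zeta>B] jac D] h\<gamma>[OF \<zeta>B] by metis
    have "((\<lambda>\<zeta>. \<gamma> \<zeta>) has_derivative (\<lambda>w. w *s E (Df (pt (2 * x * \<zeta>) y)))) (at \<zeta>)"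
      using has_derivative_compose[OF has_derivative_compose[OF P' Df(1)] E(1)]
      by (simp add: \<gamma>_def Df(2) E(2))
    then have "((\<lambda>\<zeta>. \<gamma> \<zeta> $ i) has_derivative (\<lambda>w. w * E (Df (pt (2 * x * \<zeta>) y)) $ i)) (at \<zeta>)" for i
      using bounded_linear.has_derivative[OF bounded_linear_vec_nth] by fastforce
    moreover have "(\<lambda>w. w * c) = (*) c" for c :: complex by (simp add: fun_eq_iff mult.commute)
    ultimately have "((\<lambda>\<zeta>. \<gamma> \<zeta> $ i) has_field_derivative E (Df (pt (2 * x * \<zeta>) y)) $ i) (at \<zeta>)" for i
      by (simp add: has_field_derivative_def)
    with D E(3) show ?thesis by blast
  qed
  have hol\<gamma>: "(\<lambda>\<zeta>. \<gamma> \<zeta> $ i) holomorphic_on S" for i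
  proof (rule holomorphic_onI)
    fix \<zeta> assume \<zeta>: "\<zeta> \<in> S"
    then have "P \<zeta> \<in> B2" using PB SB by blast
    then obtain Df where "(f has_derivative Df) (at (P \<zeta>))" "\<And>c v. Df (c *s v) = c *s Df v"
      using hf unfolding holomorphic_map_def by blast
    from \<gamma>'[OF \<zeta> this] show "(\<lambda>\<zeta>. \<gamma> \<zeta> $ i) field_differentiable at \<zeta> within S"
      using field_differentiable_at_within field_differentiable_def by blast
  qed
  have holj: "j holomorphic_on S"
    unfolding j_def jacobian_def
    by (intro holomorphic_intros complex_partial_compose_curve holomorphic_map_component hh \<open>open S\<close> hol\<gamma>)
      (use \<gamma>B SB in blast)+
  have clin: "(r *\<^sub>R (c *s v) :: complex ^ 2) = c *s (r *\<^sub>R v)" for r c v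
    by (simp add: vec_eq_iff scaleR_conv_of_real[where 'a = complex])
  \<comment> \<open>At the origin the derivative of \<open>h\<close> is invertible, so the curve \<open>\<gamma>\<close> is holomorphic near 0.\<close>
  have "j 0 = q\<^sup>2"
    unfolding j_def jacobian_def \<gamma>0 complex_partial_component[OF h(3) clin]
    by (simp add: axis_def scaleR_conv_of_real[where 'a = complex] power2_eq_square)
  then have "0 \<in> S" using q by (simp add: S_def)
  have d\<gamma>: "deriv (\<lambda>\<zeta>. \<gamma> \<zeta> $ i) 0 = (p / q) * pt 0 y $ i" for i
  proof -
    from \<gamma>'[OF \<open>0 \<in> S\<close>, of "\<lambda>v. p *\<^sub>R v"] clin f(3) P0 obtain E D where
      *: "\<And>i. ((\<lambda>\<zeta>. \<gamma> \<zeta> $ i) has_field_derivative E (p *\<^sub>R (pt 0 y)) $ i) (at 0)"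
        "(h has_derivative D) (at 0)" "\<And>v. D (E v) = v"
      by (auto simp: \<gamma>0)
    have "D = (\<lambda>v. q *\<^sub>R v)" using has_derivative_unique[OF *(2) h(3)] .
    with *(3) have "q *\<^sub>R E v = v" for v by metis
    then have "E v = (1 / q) *\<^sub>R v" for v
      using q by (metis divide_self_if scaleR_one scaleR_scaleR times_divide_eq_left mult_1)
    with DERIV_imp_deriv[OF *(1)] show ?thesis
      by (simp add: scaleR_conv_of_real[where 'a = complex])
  qed
  \<comment> \<open>\<open>U2\<close> and \<open>V1\<close> extend \<open>\<gamma>\<^sub>1 / \<zeta>\<^sup>2\<close> and \<open>\<gamma>\<^sub>2 / \<zeta>\<close> over the origin; the first needs the double zero of \<open>\<gamma>\<^sub>1\<close>.\<close>
  define U1 where "U1 \<zeta> = (if \<zeta> = 0 then deriv (\<lambda>\<zeta>. \<gamma> \<zeta> $ 1) 0 else \<gamma> \<zeta> $ 1 / \<zeta>)" for \<zeta> :: complex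
  define U2 where "U2 \<zeta> = (if \<zeta> = 0 then deriv U1 0 else U1 \<zeta> / \<zeta>)" for \<zeta> :: complex
  define V1 where "V1 \<zeta> = (if \<zeta> = 0 then deriv (\<lambda>\<zeta>. \<gamma> \<zeta> $ 2) 0 else \<gamma> \<zeta> $ 2 / \<zeta>)" for \<zeta> :: complex
  have U10: "U1 0 = 0" and V10: "V1 0 = p / q * y" by (simp_all add: U1_def V1_def d\<gamma>)
  have holU1: "U1 holomorphic_on S" and holV1: "V1 holomorphic_on S"
    unfolding U1_def V1_def
    by (intro difference_quotient_holomorphic hol\<gamma> \<open>open S\<close> \<open>0 \<in> S\<close>; simp add: \<gamma>0)+
  have holU2: "U2 holomorphic_on S"
    unfolding U2_def by (intro difference_quotient_holomorphic holU1 \<open>open S\<close> \<open>0 \<in> S\<close> U10)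
  have U2: "U2 \<zeta> = \<gamma> \<zeta> $ 1 / \<zeta>\<^sup>2" and V1: "V1 \<zeta> = \<gamma> \<zeta> $ 2 / \<zeta>" if "\<zeta> \<noteq> 0" for \<zeta> :: complex
    using that by (simp_all add: U2_def U1_def V1_def power2_eq_square)
  define g where "g \<zeta> = x * U2 \<zeta> + y * V1 \<zeta>" for \<zeta> :: complex
  have holg: "g holomorphic_on S"
    unfolding g_def by (intro holomorphic_intros holU2 holV1)
  have contg: "continuous_on (ball 0 1) g"
  proof -
    have "continuous_on (ball 0 1 - {0}) (\<lambda>\<zeta>. x * (\<gamma> \<zeta> $ 1 / \<zeta>\<^sup>2) + y * (\<gamma> \<zeta> $ 2 / \<zeta>))"
      by (intro continuous_intros continuous_on_subset[OF cont\<gamma>]) auto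
    then have "continuous_on (ball 0 1 - {0}) g"
      by (rule continuous_on_eq) (simp add: g_def U2 V1)
    moreover have "continuous_on S g" by (rule holomorphic_on_imp_continuous_on[OF holg])
    moreover have "open (ball 0 1 - {0::complex})" by (simp add: open_Diff)
    ultimately have "continuous_on ((ball 0 1 - {0}) \<union> S) g"
      using \<open>open S\<close> by (intro continuous_on_open_Un) auto
    then show ?thesis by (rule continuous_on_subset) (use \<open>0 \<in> S\<close> in auto)
  qed
  have lim: "U2 \<midarrow>0\<rightarrow> U2 0" "V1 \<midarrow>0\<rightarrow> V1 0"
    using holomorphic_on_imp_continuous_on[OF holU2] holomorphic_on_imp_continuous_on[OF holV1]
      \<open>open S\<close> \<open>0 \<in> S\<close> by (simp_all add: continuous_on_eq_continuous_at isCont_def)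
  have nz: "\<forall>\<^sub>F \<zeta> in at 0. \<zeta> \<noteq> (0::complex)" by (simp add: eventually_at_filter)
  have lim\<gamma>: "(\<lambda>\<zeta>. \<gamma> \<zeta> $ 1 / \<zeta>\<^sup>2) \<midarrow>0\<rightarrow> U2 0" "(\<lambda>\<zeta>. \<gamma> \<zeta> $ 2 / \<zeta>) \<midarrow>0\<rightarrow> complex_of_real (p / q * y)"
    using Lim_transform_eventually[OF lim(1) eventually_mono[OF nz U2]]
      Lim_transform_eventually[OF lim(2) eventually_mono[OF nz V1]] by (simp_all add: V10)
  have comp1: "((\<lambda>z. k z $ 1) has_derivative (\<lambda>v. complex_of_real r * v $ 1)) (at 0)"
    if "(k has_derivative (\<lambda>v. r *\<^sub>R v)) (at 0)" for k :: "complex^2 \<Rightarrow> complex^2" and r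
    using bounded_linear.has_derivative[OF bounded_linear_vec_nth that, of 1]
    by (simp add: scaleR_conv_of_real[where 'a = complex])
  \<comment> \<open>Both sides of \<open>h \<circ> \<gamma> = f \<circ> P\<close> have the same second coefficient, which determines \<open>U2 0\<close>.\<close>
  have limh: "(\<lambda>\<zeta>. h (pt (\<gamma> \<zeta> $ 1) (\<gamma> \<zeta> $ 2)) $ 1 / \<zeta>\<^sup>2) \<midarrow>0\<rightarrow> q * U2 0 + L1_02 h * (complex_of_real (p / q * y))\<^sup>2"
    unfolding L1_02_def using h(2)
    by (intro second_coefficient_along_curve[OF holomorphic_map_component[OF hh(1)] _ comp1[OF h(3)] lim\<gamma>]) auto
  have limf: "(\<lambda>\<zeta>::complex. f (pt (x * \<zeta>\<^sup>2) (y * \<zeta>)) $ 1 / \<zeta>\<^sup>2) \<midarrow>0\<rightarrow> complex_of_real p * complex_of_real x + L1_02 f * (complex_of_real y)\<^sup>2"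
    unfolding L1_02_def
  proof (intro second_coefficient_along_curve[OF holomorphic_map_component[OF hf] _ comp1[OF f(3)]])
    show "(\<lambda>\<zeta>::complex. x * \<zeta>\<^sup>2 / \<zeta>\<^sup>2) \<midarrow>0\<rightarrow> complex_of_real x" "(\<lambda>\<zeta>::complex. y * \<zeta> / \<zeta>) \<midarrow>0\<rightarrow> complex_of_real y"
      by (rule tendsto_eventually, use nz in eventually_elim, simp)+
  qed (simp add: f(2))
  have "\<forall>\<^sub>F \<zeta>::complex in at 0. h (pt (\<gamma> \<zeta> $ 1) (\<gamma> \<zeta> $ 2)) $ 1 / \<zeta>\<^sup>2 = f (pt (x * \<zeta>\<^sup>2) (y * \<zeta>)) $ 1 / \<zeta>\<^sup>2"
  proof -
    have "\<forall>\<^sub>F \<zeta> in at 0. \<zeta> \<in> ball (0::complex) 1"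
      by (rule eventually_at_in_open') auto
    then show ?thesis
      by eventually_elim (use h\<gamma> in \<open>simp add: pt_components P_def\<close>)
  qed
  from LIM_unique[OF Lim_transform_eventually[OF limh this] limf]
  have "q * U2 0 + L1_02 h * (complex_of_real (p / q * y))\<^sup>2 = complex_of_real p * complex_of_real x + L1_02 f * (complex_of_real y)\<^sup>2"
    by simp
  moreover have "complex_of_real p = complex_of_real (p / q) * complex_of_real q" using q by simp
  ultimately have "complex_of_real q * U2 0 + L1_02 h * (complex_of_real (p / q) * complex_of_real y)\<^sup>2 =
      (complex_of_real (p / q) * complex_of_real q) * complex_of_real x + L1_02 f * (complex_of_real y)\<^sup>2"
    by (metis of_real_mult)
  moreover have "(complex_of_real x)\<^sup>2 + (complex_of_real y)\<^sup>2 = 1"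
    using xy by (metis of_real_1 of_real_add of_real_power)
  moreover have "X * U + Y * (c * Y) = c + X * Y\<^sup>2 / Q * (A - c\<^sup>2 * B)"
    if "Q * U + B * (c * Y)\<^sup>2 = (c * Q) * X + A * Y\<^sup>2" "X\<^sup>2 + Y\<^sup>2 = 1" "Q \<noteq> 0" for X Y U Q A B c :: complex
  proof -
    have "Q * (X * U + Y * (c * Y)) = Q * c + X * Y\<^sup>2 * (A - c\<^sup>2 * B)"
      using that(1,2) by algebra
    then show ?thesis using \<open>Q \<noteq> 0\<close> by (simp add: field_simps)
  qed
  ultimately have "complex_of_real x * U2 0 + complex_of_real y * (complex_of_real (p / q) * complex_of_real y) =
      complex_of_real (p / q) + complex_of_real x * (complex_of_real y)\<^sup>2 / complex_of_real q *
        (L1_02 f - (complex_of_real (p / q))\<^sup>2 * L1_02 h)"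
    using q by (metis of_real_eq_0_iff)
  then have g0: "g 0 = complex_of_real (p / q) + complex_of_real (x * y\<^sup>2 / q) *
      (L1_02 f - complex_of_real ((p / q)\<^sup>2) * L1_02 h)"
    by (simp add: g_def V10)
  have "\<rho> * cmod (g 0) \<le> 1" if \<rho>: "0 < \<rho>" "\<rho> < 1" for \<rho>
  proof -
    \<comment> \<open>On the circle of radius \<open>s = \<surd>\<rho>\<close> the bound for \<open>g\<close> is \<open>1 / s\<^sup>2 = 1 / \<rho>\<close>.\<close>
    define s where "s = sqrt \<rho>"
    have s: "0 < s" "s < 1" "s\<^sup>2 = \<rho>" using \<rho> by (auto simp: s_def)
    have sub: "{\<zeta> \<in> ball 0 s. j \<zeta> \<noteq> 0} \<subseteq> S" "cball 0 s \<subseteq> ball (0::complex) 1"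
      using s by (auto simp: S_def)
    have "cmod (g 0) \<le> 1 / s\<^sup>2"
    proof (rule maximum_principle_off_zeros[where g = g and j = j and \<xi> = 0])
      show "continuous_on (cball 0 s) g" "continuous_on (cball 0 s) j"
        using contg contj sub(2) continuous_on_subset by blast+
      show "g holomorphic_on {\<zeta> \<in> ball 0 s. j \<zeta> \<noteq> 0}" "j holomorphic_on {\<zeta> \<in> ball 0 s. j \<zeta> \<noteq> 0}"
        using holg holj sub(1) holomorphic_on_subset by blast+
      show "0 \<in> ball (0::complex) s" "j 0 \<noteq> 0" using s \<open>0 \<in> S\<close> by (auto simp: S_def)
      show "0 < 1 / s\<^sup>2" using s(1) by simp
      fix \<zeta> :: complex assume \<zeta>: "cmod \<zeta> = s"
      then have "\<zeta> \<noteq> 0" "\<zeta> \<in> ball 0 1" using s by auto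
      let ?a = "cmod (\<gamma> \<zeta> $ 1)" and ?b = "cmod (\<gamma> \<zeta> $ 2)"
      have ab: "?a\<^sup>2 + ?b\<^sup>2 < 1" using \<gamma>B[OF \<open>\<zeta> \<in> ball 0 1\<close>] by (simp add: norm_C2)
      have "cmod (g \<zeta>) \<le> \<bar>x\<bar> * ?a / s\<^sup>2 + \<bar>y\<bar> * ?b / s"
        using norm_triangle_ineq[of "x * (\<gamma> \<zeta> $ 1 / \<zeta>\<^sup>2)" "y * (\<gamma> \<zeta> $ 2 / \<zeta>)"]
        by (simp add: g_def U2 V1 \<open>\<zeta> \<noteq> 0\<close> norm_mult norm_divide norm_power \<zeta>)
      also have "\<bar>y\<bar> * ?b / s \<le> \<bar>y\<bar> * ?b / s\<^sup>2"
        using s by (intro divide_left_mono) (auto simp: power2_eq_square)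
      also have "\<bar>x\<bar> * ?a / s\<^sup>2 + \<bar>y\<bar> * ?b / s\<^sup>2 = (\<bar>x\<bar> * ?a + \<bar>y\<bar> * ?b) / s\<^sup>2"
        by (simp add: add_divide_distrib)
      also have "\<dots> \<le> 1 / s\<^sup>2"
      proof (rule divide_right_mono)
        \<comment> \<open>Cauchy-Schwarz for vectors of norm at most 1, from the square of their difference.\<close>
        have "0 \<le> (\<bar>x\<bar> - ?a)\<^sup>2 + (\<bar>y\<bar> - ?b)\<^sup>2" by simp
        then show "\<bar>x\<bar> * ?a + \<bar>y\<bar> * ?b \<le> 1"
          using ab xy by (simp add: power2_diff)
      qed simp
      finally show "cmod (g \<zeta>) \<le> 1 / s\<^sup>2" by simp
    qed
    then show ?thesis using s \<rho> by (simp add: field_simps)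
  qed
  then have "cmod (g 0) \<le> 1" by (rule field_le_mult_one_interval)
  then show ?thesis by (simp add: g0)
qed

section \<open>The coefficient along a normal Loewner chain\<close>

text \<open>The real part of \<open>transition_estimate\<close>, solved for the coefficient of \<open>f\<^sub>s\<close>. The hypothesis
  \<open>c x y\<^sup>2 = 1\<close> says that \<open>c\<close> is the constant belonging to the chosen direction.\<close>

lemma Loewner_chain_step:
  assumes f: "normalized_Loewner_chain f" and t: "0 \<le> s" "0 \<le> d"
    and xy: "x\<^sup>2 + y\<^sup>2 = 1" and c: "c * (x * y\<^sup>2) = (1::real)" "0 \<le> c"
  shows "Re (L1_02 (f s)) \<le> exp (- 2 * d) * Re (L1_02 (f (s + d))) + c * exp (s + d) * (1 - exp (- d))"
proof -
  define A where "A = Re (L1_02 (f s)) - exp (- 2 * d) * Re (L1_02 (f (s + d)))"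
  have e: "exp s / exp (s + d) = exp (- d)" "(exp (- d))\<^sup>2 = exp (- 2 * d)"
    by (simp_all add: exp_diff[symmetric] exp_double[symmetric])
  from f t have fs: "univalent (f s)" "f s 0 = 0" "(f s has_derivative (\<lambda>v. exp s *\<^sub>R v)) (at 0)"
    and ft: "univalent (f (s + d))" "f (s + d) 0 = 0"
      "(f (s + d) has_derivative (\<lambda>v. exp (s + d) *\<^sub>R v)) (at 0)"
    and sub: "f s ` B2 \<subseteq> f (s + d) ` B2"
    unfolding normalized_Loewner_chain_def by (auto simp: add_nonneg_nonneg)
  from transition_estimate[OF fs ft sub _ xy]
  have "Re (complex_of_real (exp (- d)) + complex_of_real (x * y\<^sup>2 / exp (s + d)) *
      (L1_02 (f s) - complex_of_real (exp (- 2 * d)) * L1_02 (f (s + d)))) \<le> 1"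
    unfolding e by (intro order_trans[OF complex_Re_le_cmod]) auto
  then have "exp (- d) + x * y\<^sup>2 / exp (s + d) * A \<le> 1"
    by (simp add: A_def)
  then have "x * y\<^sup>2 / exp (s + d) * A \<le> 1 - exp (- d)" by simp
  from mult_left_mono[OF this, of "c * exp (s + d)"] c
  have "c * (x * y\<^sup>2) * A \<le> c * exp (s + d) * (1 - exp (- d))"
    by (simp add: mult_ac)
  then show ?thesis using c by (simp add: A_def)
qed

text \<open>Multiplied by \<open>e\<^sup>-\<^sup>2\<^sup>k\<^sup>d\<close>, the gain in step \<open>k\<close> becomes \<open>c e\<^sup>d (e\<^sup>-\<^sup>k\<^sup>d - e\<^sup>-\<^sup>(\<^sup>k\<^sup>+\<^sup>1\<^sup>)\<^sup>d)\<close>, a telescoping sum.\<close>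

lemma Loewner_chain_telescope:
  assumes f: "normalized_Loewner_chain f" and d: "0 \<le> d"
    and xy: "x\<^sup>2 + y\<^sup>2 = 1" and c: "c * (x * y\<^sup>2) = (1::real)" "0 \<le> c"
  shows "Re (L1_02 (f 0)) \<le> exp (- 2 * (real n * d)) * Re (L1_02 (f (real n * d))) + c * exp d * (1 - exp (- (n * d)))"
proof (induction n)
  case 0
  show ?case by simp
next
  case (Suc n)
  let ?s = "real n * d"
  let ?a = "Re (L1_02 (f (?s + d)))"
  have "exp (- 2 * ?s) * Re (L1_02 (f ?s)) \<le>
      exp (- 2 * ?s) * (exp (- 2 * d) * ?a + c * exp (?s + d) * (1 - exp (- d)))"
    using d by (intro mult_left_mono Loewner_chain_step[OF f _ d xy c]) auto
  also have "\<dots> = exp (- 2 * (?s + d)) * ?a + c * exp d * (exp (- ?s) - exp (- (?s + d)))"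
  proof -
    have "exp (- 2 * ?s) = exp (- ?s) * exp (- ?s)" "exp (- 2 * (?s + d)) = exp (- 2 * ?s) * exp (- 2 * d)"
      "exp (- (?s + d)) = exp (- ?s) * exp (- d)" "exp (?s + d) = exp ?s * exp d" "exp (- ?s) * exp ?s = 1"
      by (simp_all flip: exp_add)
    then show ?thesis by algebra
  qed
  finally have "Re (L1_02 (f 0)) \<le> exp (- 2 * (?s + d)) * ?a + c * exp d * (exp (- ?s) - exp (- (?s + d)))
      + c * exp d * (1 - exp (- ?s))"
    using Suc by linarith
  then have "Re (L1_02 (f 0)) \<le> exp (- 2 * (?s + d)) * ?a + c * exp d * (1 - exp (- (?s + d)))"
    by (simp add: algebra_simps)
  moreover have "?s + d = real (Suc n) * d" by (simp add: algebra_simps)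
  ultimately show ?case by simp
qed

lemma L1_02_eq: "L1_02 f = 1 / 2 * (deriv ^^ 2) (\<lambda>w. f (w *s axis 2 1) $ 1) 0"
  by (simp add: L1_02_def complex_partial_twice_at_0)

lemma eventually_slice_in_B2: "\<forall>\<^sub>F w in nhds 0. w *s axis j 1 \<in> B2"
proof -
  have "w *s axis j 1 \<in> B2" if "w \<in> ball 0 1" for w
    using slice_in_ball[of 0 0 w 1 j] that by simp
  then show ?thesis
    using eventually_nhds_in_open[OF open_ball[of 0 "1::real"], of "0::complex"] by (auto elim: eventually_mono)
qed

lemma L1_02_cong: "(\<And>z. z \<in> B2 \<Longrightarrow> f z = g z) \<Longrightarrow> L1_02 f = L1_02 g"
  unfolding L1_02_eq
  by (intro arg_cong2[where f = "(*)"] higher_deriv_cong_ev refl eventually_mono[OF eventually_slice_in_B2[of 2]]) auto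

lemma L1_02_Cauchy_bound:
  assumes f: "holomorphic_map f B2" and B: "\<And>w. cmod w = 1/2 \<Longrightarrow> norm (f (w *s axis 2 1)) \<le> B"
  shows "cmod (L1_02 f) \<le> 4 * B"
proof -
  have hol: "(\<lambda>w. f (w *s axis 2 1) $ 1) holomorphic_on ball 0 1"
    by (rule slice_holomorphic[OF holomorphic_map_component[OF f]])
  have "cmod ((deriv ^^ 2) (\<lambda>w. f (w *s axis 2 1) $ 1) 0) \<le> fact 2 * B / (1/2) ^ 2"
  proof (rule Cauchy_inequality)
    show "(\<lambda>w. f (w *s axis 2 1) $ 1) holomorphic_on ball 0 (1/2)"
      by (rule holomorphic_on_subset[OF hol]) auto
    show "continuous_on (cball 0 (1/2)) (\<lambda>w. f (w *s axis 2 1) $ 1)"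
      by (rule continuous_on_subset[OF holomorphic_on_imp_continuous_on[OF hol]]) auto
    show "cmod (f (w *s axis 2 1) $ 1) \<le> B" if "cmod (0 - w) = 1/2" for w
      using B[of w] that Finite_Cartesian_Product.norm_nth_le[of "f (w *s axis 2 1)" 1] by simp
  qed simp
  then show ?thesis by (simp add: L1_02_eq norm_mult power2_eq_square)
qed

text \<open>Uniform convergence of a subsequence on the circle of radius 1/2 in the \<open>z\<^sub>2\<close>-axis bounds the rescaled maps
  there, and Cauchy's inequality turns this into a bound for the coefficient.\<close>

lemma normal_family_coefficients_bounded:
  assumes N: "normal_family B2 ((\<lambda>t z. exp (- t) *\<^sub>R f t z) ` {0..})"
    and f: "\<And>t. 0 \<le> t \<Longrightarrow> holomorphic_map (f t) B2" and t: "\<And>n::nat. 0 \<le> t n"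
  obtains r B where "strict_mono r" "\<And>n::nat. cmod (L1_02 (f (t (r n)))) \<le> B * exp (t (r n))"
proof -
  let ?K = "(\<lambda>w. w *s axis 2 1) ` sphere 0 (1/2) :: (complex ^ 2) set"
  have cl: "continuous_on (sphere 0 (1/2)) (\<lambda>w::complex. w *s axis 2 1 :: complex ^ 2)"
    by (rule continuous_on_C2) (simp, intro continuous_intros)
  have K: "compact ?K" "?K \<subseteq> B2"
    using slice_in_ball[of 0 0 _ 1 2] by (auto intro!: compact_continuous_image cl simp del: mem_ball)
  have "range (\<lambda>n z. exp (- t n) *\<^sub>R f (t n) z) \<subseteq> (\<lambda>t z. exp (- t) *\<^sub>R f t z) ` {0..}"
    using t by auto
  from N[unfolded normal_family_def, rule_format, OF this] K obtain r g where r: "strict_mono r"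
    and ul: "uniform_limit ?K (\<lambda>n z. exp (- t (r n)) *\<^sub>R f (t (r n)) z) g sequentially"
    by blast
  have hol: "continuous_on B2 (f (t n))" for n
    using f[OF t] unfolding holomorphic_map_def
    by (meson continuous_at_imp_continuous_on has_derivative_continuous)
  have "bounded ((\<lambda>z. exp (- t (r n)) *\<^sub>R f (t (r n)) z) ` ?K)" for n
  proof -
    have "continuous_on ?K (\<lambda>z. exp (- t (r n)) *\<^sub>R f (t (r n)) z)"
      by (intro continuous_on_scaleR continuous_on_const continuous_on_subset[OF hol K(2)])
    then show ?thesis using compact_continuous_image[OF _ K(1)] compact_imp_bounded by blast
  qed
  then have "bounded (g ` ?K)"
    by (intro uniform_limit_bounded[OF ul]) auto
  then obtain M where M: "\<And>z. z \<in> ?K \<Longrightarrow> norm (g z) \<le> M" by (auto simp: bounded_iff)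
  obtain N where N: "\<And>n z. n \<ge> N \<Longrightarrow> z \<in> ?K \<Longrightarrow> dist (exp (- t (r n)) *\<^sub>R f (t (r n)) z) (g z) < 1"
    using uniform_limitD[OF ul, of 1] by (auto simp: eventually_sequentially)
  show thesis
  proof (rule that[of "\<lambda>n. r (n + N)" "4 * (M + 1)"])
    show "strict_mono (\<lambda>n. r (n + N))" using r by (simp add: strict_mono_def)
    fix n
    let ?t = "t (r (n + N))"
    have "cmod (L1_02 (f ?t)) \<le> 4 * (exp ?t * (M + 1))"
    proof (rule L1_02_Cauchy_bound[OF f[OF t]])
      fix w :: complex assume "cmod w = 1/2"
      then have w: "w *s axis 2 1 \<in> ?K" by auto
      have "norm (exp (- ?t) *\<^sub>R f ?t (w *s axis 2 1)) \<le> M + 1"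
        using N[OF _ w, of "n + N"] M[OF w] norm_triangle_sub[of "exp (- ?t) *\<^sub>R f ?t (w *s axis 2 1)" "g (w *s axis 2 1)"]
        by (simp add: dist_norm)
      then show "norm (f ?t (w *s axis 2 1)) \<le> exp ?t * (M + 1)"
        by (simp add: exp_minus field_simps)
    qed
    then show "cmod (L1_02 (f ?t)) \<le> 4 * (M + 1) * exp ?t" by (simp add: algebra_simps)
  qed
qed

lemma normal_Loewner_chain_coefficient_bound:
  assumes f: "normal_Loewner_chain f"
    and xy: "x\<^sup>2 + y\<^sup>2 = 1" and c: "c * (x * y\<^sup>2) = (1::real)" "0 \<le> c"
  shows "Re (L1_02 (f 0)) \<le> c"
proof -
  have nf: "normalized_Loewner_chain f" and N: "normal_family B2 ((\<lambda>t z. exp (- t) *\<^sub>R f t z) ` {0..})"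
    using f by (auto simp: normal_Loewner_chain_def)
  have hol: "holomorphic_map (f t) B2" if "0 \<le> t" for t
    using nf that by (auto simp: normalized_Loewner_chain_def univalent_def)
  have le: "Re (L1_02 (f 0)) \<le> c * exp d" if d: "0 < d" for d
  proof -
    obtain r :: "nat \<Rightarrow> nat" and B where r: "strict_mono r"
      and B: "\<And>n. cmod (L1_02 (f (real (r n) * d))) \<le> B * exp (real (r n) * d)"
      using normal_family_coefficients_bounded[OF N hol, of "\<lambda>n. real n * d"] d by auto
    have bound: "Re (L1_02 (f 0)) \<le> B * exp (- (real (r n) * d)) + c * exp d" for n
    proof -
      have "Re (L1_02 (f (real (r n) * d))) \<le> B * exp (real (r n) * d)"
        by (rule order_trans[OF complex_Re_le_cmod B])
      then have "exp (- 2 * (real (r n) * d)) * Re (L1_02 (f (real (r n) * d))) \<le> exp (- 2 * (real (r n) * d)) * (B * exp (real (r n) * d))"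
        by (intro mult_left_mono) auto
      also have "\<dots> = B * exp (- (real (r n) * d))"
        by (simp add: mult.left_commute flip: exp_add)
      finally have "exp (- 2 * (real (r n) * d)) * Re (L1_02 (f (real (r n) * d))) \<le> B * exp (- (real (r n) * d))" .
      moreover have "c * exp d * (1 - exp (- (real (r n) * d))) \<le> c * exp d"
        using c(2) by (simp add: mult_left_le)
      ultimately show ?thesis
        using Loewner_chain_telescope[OF nf _ xy c, of d "r n"] d by linarith
    qed
    have "filterlim (\<lambda>n. real (r n) * d) at_top sequentially"
      by (rule filterlim_at_top_mult_tendsto_pos[OF tendsto_const d])
        (rule filterlim_compose[OF filterlim_real_sequentially filterlim_subseq[OF r]])
    then have "(\<lambda>n. exp (- (real (r n) * d))) \<longlonglongrightarrow> 0"
      by (intro filterlim_compose[OF exp_at_bot] filterlim_compose[OF filterlim_uminus_at_bot_at_top])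
    then have "(\<lambda>n. B * exp (- (real (r n) * d)) + c * exp d) \<longlonglongrightarrow> B * 0 + c * exp d"
      by (intro tendsto_intros)
    then show ?thesis
      using bound by (intro LIMSEQ_le_const[where X = "\<lambda>n. B * exp (- (real (r n) * d)) + c * exp d"]) auto
  qed
  have "((\<lambda>d. c * exp d) \<longlongrightarrow> c * exp 0) (at_right (0::real))"
    by (intro tendsto_intros)
  then have "((\<lambda>d. c * exp d) \<longlongrightarrow> c) (at_right (0::real))" by simp
  moreover have "\<forall>\<^sub>F d in at_right (0::real). Re (L1_02 (f 0)) \<le> c * exp d"
    using le by (auto simp: eventually_at_right_less intro: eventually_mono[OF eventually_at_right_less])
  ultimately show ?thesis by (rule tendsto_lowerbound) simp
qed

section \<open>The extremal map\<close>

text \<open>The inequality between arithmetic and geometric means of \<open>u\<^sup>2\<close>, \<open>w/2\<close>, \<open>w/2\<close> gives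
  \<open>27/4 u\<^sup>2 w\<^sup>2 \<le> (u\<^sup>2 + w)\<^sup>3\<close>, and in the unit ball the cube is at most the square. This is where the
  constant \<open>3\<surd>3/2\<close> enters the starlikeness of \<open>\<Phi>\<close>.\<close>

lemma sqrt3_cubic_bound:
  fixes u w :: real
  assumes "0 \<le> w" "u\<^sup>2 + w \<le> 1"
  shows "3 * sqrt 3 / 2 * (u * w) \<le> u\<^sup>2 + w"
proof (rule power2_le_imp_le)
  have "(3 * sqrt 3 / 2 * (u * w))\<^sup>2 = 27 / 4 * u\<^sup>2 * w\<^sup>2"
    by (simp add: power_mult_distrib power_divide)
  also have "\<dots> \<le> (u\<^sup>2 + w) ^ 3"
  proof -
    \<comment> \<open>The difference vanishes doubly at the maximiser \<open>w = 2 u\<^sup>2\<close>.\<close>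
    have "0 \<le> (w - 2 * u\<^sup>2)\<^sup>2 * (w + u\<^sup>2 / 4)" using assms(1) by simp
    also have "\<dots> = (u\<^sup>2 + w) ^ 3 - 27 / 4 * u\<^sup>2 * w\<^sup>2"
      by (simp add: field_simps power2_eq_square power3_eq_cube)
    finally show ?thesis by simp
  qed
  also have "\<dots> \<le> (u\<^sup>2 + w)\<^sup>2"
    using assms by (intro power_decreasing) auto
  finally show "(3 * sqrt 3 / 2 * (u * w))\<^sup>2 \<le> (u\<^sup>2 + w)\<^sup>2" .
qed (use assms in auto)

text \<open>The left side is the squared norm \<open>N(r)\<close> of the preimage of \<open>r \<Phi>(x, y)\<close> under \<open>\<Phi>\<close>. It satisfies
  \<open>r N' = 2 (N - c u v\<^sup>2)\<close> with \<open>(u, v)\<close> the preimage, which is nonnegative as long as \<open>N \<le> 1\<close>, by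
  \<open>sqrt3_cubic_bound\<close>. So \<open>N\<close> does not grow while \<open>r\<close> runs from 1 down to 0.\<close>

lemma dilated_preimage_bound:
  fixes x y r :: real
  assumes xy: "x\<^sup>2 + y\<^sup>2 < 1" and r: "0 \<le> r" "r \<le> 1"
  shows "(r * (x + 3 * sqrt 3 / 2 * (1 - r) * y\<^sup>2))\<^sup>2 + (r * y)\<^sup>2 < 1"
proof -
  define c :: real where "c = 3 * sqrt 3 / 2"
  define u where "u \<tau> = \<tau> * (x + c * (1 - \<tau>) * y\<^sup>2)" for \<tau>
  define N where "N \<tau> = (u \<tau>)\<^sup>2 + (\<tau> * y)\<^sup>2" for \<tau>
  define N' where "N' \<tau> = 2 * u \<tau> * (x + c * (1 - 2 * \<tau>) * y\<^sup>2) + 2 * \<tau> * y\<^sup>2" for \<tau>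
  have der: "(N has_field_derivative N' \<tau>) (at \<tau>)" for \<tau>
    unfolding N_def u_def N'_def
    by (auto intro!: derivative_eq_intros simp: algebra_simps power2_eq_square)
  have cont: "continuous_on A N" for A
    using der by (meson DERIV_continuous continuous_at_imp_continuous_on)
  have N': "0 \<le> N' \<tau>" if "0 < \<tau>" "N \<tau> \<le> 1" for \<tau>
  proof -
    have "c * (u \<tau> * (\<tau> * y)\<^sup>2) \<le> N \<tau>"
      using sqrt3_cubic_bound[of "(\<tau> * y)\<^sup>2" "u \<tau>"] that(2) by (simp add: N_def c_def)
    moreover have "\<tau> * N' \<tau> = 2 * (N \<tau> - c * (u \<tau> * (\<tau> * y)\<^sup>2))"
      by (simp add: N'_def N_def u_def algebra_simps power2_eq_square)
    ultimately have "0 \<le> \<tau> * N' \<tau>" by simp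
    then show ?thesis using that(1) by (simp add: zero_le_mult_iff)
  qed
  have N1: "N 1 < 1" using xy by (simp add: N_def u_def)
  have "N r < 1"
  proof (rule ccontr)
    \<comment> \<open>Beyond the last point where \<open>N\<close> is at least 1 it cannot decrease, yet \<open>N 1 < 1\<close>.\<close>
    assume "\<not> N r < 1"
    then have ne: "r \<in> {r..1} \<inter> {\<tau>. 1 \<le> N \<tau>}" using r by simp
    have "compact ({r..1} \<inter> {\<tau>. 1 \<le> N \<tau>})"
      by (intro compact_Int_closed closed_Collect_le cont continuous_on_const) auto
    with ne obtain m where m: "m \<in> {r..1} \<inter> {\<tau>. 1 \<le> N \<tau>}"
      and max: "\<And>\<tau>. \<tau> \<in> {r..1} \<inter> {\<tau>. 1 \<le> N \<tau>} \<Longrightarrow> \<tau> \<le> m"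
      using compact_attains_sup by (metis empty_iff)
    have "N m \<le> N 1"
    proof (rule DERIV_nonneg_imp_increasing_open[where f = N])
      fix \<tau> assume \<tau>: "m < \<tau>" "\<tau> < 1"
      then have "N \<tau> \<le> 1" using max[of \<tau>] m by force
      then show "\<exists>d. (N has_field_derivative d) (at \<tau>) \<and> 0 \<le> d"
        using der N' \<tau> m r by force
    qed (use m cont in auto)
    with m N1 show False by simp
  qed
  then show ?thesis by (simp add: N_def u_def c_def)
qed

lemma Phi_components: "Phi z $ 1 = z $ 1 + complex_of_real (3 * sqrt 3 / 2) * (z $ 2)\<^sup>2" "Phi z $ 2 = z $ 2"
  by (simp_all add: Phi_def)

lemma Phi_has_derivative:
  "(Phi has_derivative (\<lambda>v. pt (v $ 1 + complex_of_real (3 * sqrt 3) * z $ 2 * v $ 2) (v $ 2))) (at z)"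
proof -
  have [derivative_intros]: "((\<lambda>z. z $ i) has_derivative (\<lambda>v. v $ i)) (at z)" for i :: 2 and z :: "complex ^ 2"
    by (rule bounded_linear_imp_has_derivative[OF bounded_linear_vec_nth])
  show ?thesis
    unfolding has_derivative_C2_iff Phi_components
    by (auto intro!: derivative_eq_intros simp: fun_eq_iff)
qed

lemma Phi_0: "Phi 0 = 0"
  by (simp add: vec_eq_iff forall_2 Phi_components)

lemma inj_Phi: "inj Phi"
proof (rule injI)
  fix z w assume "Phi z = Phi w"
  then have "Phi z $ 1 = Phi w $ 1" "Phi z $ 2 = Phi w $ 2" by simp_all
  then show "z = w" by (simp add: Phi_components vec_eq_iff forall_2)
qed

lemma univalent_scaled_Phi: "r \<noteq> 0 \<Longrightarrow> univalent (\<lambda>z. r *\<^sub>R Phi z)"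
proof -
  assume r: "r \<noteq> 0"
  have "holomorphic_map (\<lambda>z. r *\<^sub>R Phi z) B2"
    unfolding holomorphic_map_def
  proof
    fix z :: "complex ^ 2"
    have "((\<lambda>z. r *\<^sub>R Phi z) has_derivative
        (\<lambda>v. r *\<^sub>R pt (v $ 1 + complex_of_real (3 * sqrt 3) * z $ 2 * v $ 2) (v $ 2))) (at z)"
      by (intro has_derivative_scaleR_right Phi_has_derivative)
    moreover have "\<forall>k v. r *\<^sub>R pt ((k *s v) $ 1 + complex_of_real (3 * sqrt 3) * z $ 2 * (k *s v) $ 2) ((k *s v) $ 2)
        = k *s (r *\<^sub>R pt (v $ 1 + complex_of_real (3 * sqrt 3) * z $ 2 * v $ 2) (v $ 2))"
      by (simp add: vec_eq_iff forall_2 algebra_simps)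
    ultimately show "\<exists>D. ((\<lambda>z. r *\<^sub>R Phi z) has_derivative D) (at z) \<and> (\<forall>c v. D (c *s v) = c *s D v)"
      by blast
  qed
  moreover have "inj_on (\<lambda>z. r *\<^sub>R Phi z) B2"
    using r inj_Phi by (auto simp: inj_on_def)
  ultimately show ?thesis by (simp add: univalent_def)
qed

text \<open>The preimage of \<open>r \<Phi>(z)\<close> is explicit, and for given moduli of the components of \<open>z\<close> its norm is
  largest when they are real and nonnegative; this is the case of \<open>dilated_preimage_bound\<close>.\<close>

lemma scaleR_Phi_in_image:
  assumes z: "z \<in> B2" and r: "0 \<le> r" "r \<le> 1"
  shows "r *\<^sub>R Phi z \<in> Phi ` B2"
proof
  define c :: real where "c = 3 * sqrt 3 / 2"
  define w where "w = pt (r * (z $ 1 + complex_of_real (c * (1 - r)) * (z $ 2)\<^sup>2)) (r * z $ 2)"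
  show "r *\<^sub>R Phi z = Phi w"
    unfolding vec_eq_iff forall_2 vector_scaleR_component Phi_components c_def[symmetric]
    by (simp add: w_def scaleR_conv_of_real[where 'a = complex] algebra_simps power2_eq_square)
  have "cmod (z $ 1 + complex_of_real (c * (1 - r)) * (z $ 2)\<^sup>2) \<le> cmod (z $ 1) + c * (1 - r) * (cmod (z $ 2))\<^sup>2"
  proof -
    have "cmod (complex_of_real (c * (1 - r)) * (z $ 2)\<^sup>2) = c * (1 - r) * (cmod (z $ 2))\<^sup>2"
      unfolding norm_mult norm_power norm_of_real using r by (simp add: c_def abs_mult)
    then show ?thesis using norm_triangle_ineq[of "z $ 1" "complex_of_real (c * (1 - r)) * (z $ 2)\<^sup>2"] by simp
  qed
  then have "cmod (w $ 1) \<le> r * (cmod (z $ 1) + c * (1 - r) * (cmod (z $ 2))\<^sup>2)"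
    using r by (simp add: w_def norm_mult mult_left_mono del: of_real_mult of_real_diff)
  then have "(cmod (w $ 1))\<^sup>2 + (cmod (w $ 2))\<^sup>2 \<le>
      (r * (cmod (z $ 1) + c * (1 - r) * (cmod (z $ 2))\<^sup>2))\<^sup>2 + (r * cmod (z $ 2))\<^sup>2"
    using r by (intro add_mono power_mono) (auto simp: w_def norm_mult)
  also have "\<dots> < 1"
    using dilated_preimage_bound[of "cmod (z $ 1)" "cmod (z $ 2)" r] z r by (simp add: norm_C2 c_def)
  finally show "w \<in> B2" by (simp add: norm_C2)
qed

lemma starlike_map_Phi: "starlike_map Phi"
  using univalent_scaled_Phi[of 1] scaleR_Phi_in_image Phi_0
  by (auto simp: starlike_map_def)

lemma normal_Loewner_chain_Phi: "normal_Loewner_chain (\<lambda>t z. exp t *\<^sub>R Phi z)"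
proof -
  have "(\<lambda>z. exp s *\<^sub>R Phi z) ` B2 \<subseteq> (\<lambda>z. exp t *\<^sub>R Phi z) ` B2" if "s \<le> t" for s t :: real
  proof
    fix w assume "w \<in> (\<lambda>z. exp s *\<^sub>R Phi z) ` B2"
    then obtain z where z: "z \<in> B2" "w = exp s *\<^sub>R Phi z" by blast
    have "exp (s - t) *\<^sub>R Phi z \<in> Phi ` B2"
      using scaleR_Phi_in_image[OF z(1), of "exp (s - t)"] that by simp
    then obtain z' where "z' \<in> B2" "exp (s - t) *\<^sub>R Phi z = Phi z'" by blast
    then have "w = exp t *\<^sub>R Phi z'"
      using z(2) by (metis add.commute diff_add_cancel exp_add scaleR_scaleR)
    with \<open>z' \<in> B2\<close> show "w \<in> (\<lambda>z. exp t *\<^sub>R Phi z) ` B2" by blast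
  qed
  moreover have "((\<lambda>z. exp t *\<^sub>R Phi z) has_derivative (\<lambda>v. exp t *\<^sub>R v)) (at 0)" for t :: real
    using has_derivative_scaleR_right[OF Phi_has_derivative[of 0], of "exp t"] by (simp add: pt_components)
  ultimately have "normalized_Loewner_chain (\<lambda>t z. exp t *\<^sub>R Phi z)"
    using univalent_scaled_Phi Phi_0 by (simp add: normalized_Loewner_chain_def)
  moreover have "normal_family B2 ((\<lambda>t z. exp (- t) *\<^sub>R exp t *\<^sub>R Phi z) ` {0..})"
    unfolding normal_family_def
  proof (intro allI impI)
    fix F :: "nat \<Rightarrow> complex ^ 2 \<Rightarrow> complex ^ 2"
    assume "range F \<subseteq> (\<lambda>t z. exp (- t) *\<^sub>R exp t *\<^sub>R Phi z) ` {0..}"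
    also have "\<dots> \<subseteq> {Phi}" by (auto simp: fun_eq_iff simp flip: exp_add)
    finally have "F n = Phi" for n by blast
    then show "\<exists>r g. strict_mono r \<and> (\<forall>K. compact K \<and> K \<subseteq> B2 \<longrightarrow> uniform_limit K (\<lambda>n. F (r n)) g sequentially)"
      by (intro exI[of _ "\<lambda>n. n"] exI[of _ Phi]) (simp add: strict_mono_def uniform_limit_const)
  qed
  ultimately show ?thesis by (simp add: normal_Loewner_chain_def)
qed

lemma Phi_in_S0: "Phi \<in> S0"
proof -
  have "univalent Phi" using univalent_scaled_Phi[of 1] by simp
  moreover have "(Phi has_derivative (\<lambda>v. v)) (at 0)"
    using Phi_has_derivative[of 0] by (simp add: pt_components)
  moreover have "\<exists>f. normal_Loewner_chain f \<and> (\<forall>z\<in>B2. f 0 z = Phi z)"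
    using normal_Loewner_chain_Phi by (intro exI[of _ "\<lambda>t z. exp t *\<^sub>R Phi z"]) simp
  ultimately show ?thesis by (simp add: S0_def Phi_0)
qed

lemma L1_02_Phi: "L1_02 Phi = complex_of_real (3 * sqrt 3 / 2)"
proof -
  define c where "c = complex_of_real (3 * sqrt 3 / 2)"
  have "((\<lambda>w. c * w\<^sup>2) has_field_derivative 2 * c * w) (at w)" "((\<lambda>w. 2 * c * w) has_field_derivative 2 * c) (at w)" for w
    by (auto intro!: derivative_eq_intros)
  then have d: "deriv (\<lambda>w. c * w\<^sup>2) = (\<lambda>w. 2 * c * w)" "deriv (\<lambda>w. 2 * c * w) = (\<lambda>w. 2 * c)"
    by (simp_all add: fun_eq_iff DERIV_imp_deriv)
  have "(\<lambda>w. Phi (w *s axis 2 1) $ 1) = (\<lambda>w. c * w\<^sup>2)"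
    by (simp add: Phi_components axis_def c_def)
  moreover have "(deriv ^^ 2) (\<lambda>w. c * w\<^sup>2) 0 = 2 * c"
  proof -
    have "(deriv ^^ 2) k = deriv (deriv k)" for k :: "complex \<Rightarrow> complex" by (simp add: numeral_2_eq_2)
    then show ?thesis by (simp add: d)
  qed
  ultimately show ?thesis
    unfolding L1_02_eq c_def[symmetric] by simp
qed

lemma Re_L1_02_le:
  assumes "h \<in> S0"
  shows "Re (L1_02 h) \<le> 3 * sqrt 3 / 2"
proof -
  obtain f where f: "normal_Loewner_chain f" "\<And>z. z \<in> B2 \<Longrightarrow> f 0 z = h z"
    using assms by (auto simp: S0_def)
  \<comment> \<open>The point of the unit circle at which \<open>x y\<^sup>2\<close> is largest.\<close>
  have xy: "(1 / sqrt 3)\<^sup>2 + (sqrt (2 / 3))\<^sup>2 = 1"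
    and c: "3 * sqrt 3 / 2 * (1 / sqrt 3 * (sqrt (2 / 3))\<^sup>2) = 1"
    by (simp_all add: power_divide)
  have "Re (L1_02 (f 0)) \<le> 3 * sqrt 3 / 2"
    by (rule normal_Loewner_chain_coefficient_bound[OF f(1) xy c]) simp
  then show ?thesis
    using L1_02_cong[OF f(2)] by simp
qed

section \<open>The maximum\<close>

theorem theorem1p1:
  shows "Phi \<in> S0 \<and> starlike_map Phi \<and> (\<forall>h\<in>S0. Re (L1_02 h) \<le> Re (L1_02 Phi))"
  using Phi_in_S0 starlike_map_Phi Re_L1_02_le by (simp add: L1_02_Phi)

end
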